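(* For $n\ge1$ let $f(n)$ be the number of elements in the congruence lattice of the slow Tamari lattice $\operatorname{sTam}_n$, and set $f(0)=1$. Then, as formal power series, $$F(x):=\sum_{n\ge0}f(n)x^n=\cfrac{1}{1-\cfrac{x}{1-x\,N\!\left(\tfrac34,4x\right)}},\qquad\text{where}\qquad N(\ell,x):=\frac{1+x-\ell x-\sqrt{1-2(\ell+1)x+(\ell-1)^2x^2}}{2x}.$$ Equivalently, $$F(x)=\cfrac{1}{1-\cfrac{x}{1-\cfrac{x}{1+x-\cfrac{4x}{1+x-\cfrac{4x}{1+x-\cfrac{4x}{1+x-\cdots}}}}}}.$$
   Context: Let $n$ be a positive integer. The board of size $n$ is the Ferrers diagram of shape $(n,n,n-1,n-2,\dots,3,2)$ (a single cell $(1,1)$ if $n=1$). Its cells are written $(i,j)$, where $i$ is the row, numbered from the top, and $j$ is the column label, the columns being labelled $n,n-1,\dots,1$ from left to right. So the cells are $(1,j)$ for $1\le j\le n$ and $(i,j)$ for $2\le i\le n$, $i-1\le j\le n$. The root is $(1,n)$ (top-left cell); the border cells are $(i,i-1)$ for $2\le i\le n$ (the rightmost cells of rows $2,\dots,n$). An fb-tableau of size $n$ is a filling in which each cell is either empty or nonempty such that the root and all border cells are nonempty, and every nonempty cell other than the root has a nonempty cell strictly to its left in the same row or strictly above it in the same column. In an fb-tableau, a nonempty cell different from the root is called a left-arrow if there is no nonempty cell strictly to its left in its row, an up-arrow if there is no nonempty cell strictly above it in its column, and a dot otherwise; the root is also a dot. (Each of rows $2,\dots,n$ has exactly one left-arrow,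 each of columns $1,\dots,n-1$ has exactly one up-arrow.) A cell is free in $T$ if it lies strictly below an up-arrow (same column) and strictly to the right of a left-arrow (same row); a free cell is either empty or contains a dot. $\operatorname{Row}(T)$ is the set of cells lying weakly to the right of a left-arrow or of the root in the same row; $\operatorname{Col}(T)$ is the set of cells lying weakly below an up-arrow or the root in the same column. For fb-tableaux $S,T$ of size $n$, write $S\lhd T$ if (1) $\operatorname{Col}(S)\subseteq\operatorname{Col}(T)$; (2) $\operatorname{Row}(T)\subseteq\operatorname{Row}(S)$; (3) for every cell $c$ that is free in both $S$ and $T$, if $c$ contains a dot in $S$ then $c$ contains a dot in $T$. An fb-tableau is small if its only dot is the root (equivalently, all its free cells are empty). The slow Tamari lattice $\operatorname{sTam}_n$ is the set of small fb-tableaux of size $n$ ordered by $\lhd$; it is a finite lattice. A congruence of a lattice is an equivalence relation compatible with $\wedge$ and $\vee$; the congruence lattice is the set of all congruences ordered by inclusion. The square root denotes the power series with constant term $1$, and the infinite continued fraction (in which, from the third level on, all numerators are $4x$ and all denominators begin with $1+x$) denotes the coefficientwise limit of its finite truncations. *)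

theory Defs
  imports "HOL-Algebra.Lattice" "HOL-Computational_Algebra.Formal_Power_Series"
begin

text \<open>
  A cell \<open>(i, j)\<close> lies in row \<open>i\<close> (numbered from the top) and in the column labelled \<open>j\<close>.
  Column labels decrease from left to right, so a cell is further to the left when its second
  component is larger.
\<close>

type_synonym cell = "nat \<times> nat"

definition board :: "nat \<Rightarrow> cell set" where
  "board n = {(i, j). (i = 1 \<and> 1 \<le> j \<and> j \<le> n) \<or> (2 \<le> i \<and> i \<le> n \<and> i - 1 \<le> j \<and> j \<le> n)}"

definition root_cell :: "nat \<Rightarrow> cell" where
  "root_cell n = (1, n)"

definition border :: "nat \<Rightarrow> cell set" where
  "border n = {(i, i - 1) | i. 2 \<le> i \<and> i \<le> n}"

definition strictly_left :: "cell \<Rightarrow> cell \<Rightarrow> bool" where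
  "strictly_left c d \<longleftrightarrow> fst c = fst d \<and> snd c > snd d"

definition strictly_above :: "cell \<Rightarrow> cell \<Rightarrow> bool" where
  "strictly_above c d \<longleftrightarrow> snd c = snd d \<and> fst c < fst d"

text \<open>A filling is represented by its set \<open>T\<close> of nonempty cells.\<close>

definition fb_tableau :: "nat \<Rightarrow> cell set \<Rightarrow> bool" where
  "fb_tableau n T \<longleftrightarrow>
     T \<subseteq> board n \<and> root_cell n \<in> T \<and> border n \<subseteq> T \<and>
     (\<forall>c\<in>T. c \<noteq> root_cell n \<longrightarrow> (\<exists>d\<in>T. strictly_left d c \<or> strictly_above d c))"

definition left_arrow :: "nat \<Rightarrow> cell set \<Rightarrow> cell \<Rightarrow> bool" where
  "left_arrow n T c \<longleftrightarrow> c \<in> T \<and> c \<noteq> root_cell n \<and> \<not> (\<exists>d\<in>T. strictly_left d c)"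

definition up_arrow :: "nat \<Rightarrow> cell set \<Rightarrow> cell \<Rightarrow> bool" where
  "up_arrow n T c \<longleftrightarrow> c \<in> T \<and> c \<noteq> root_cell n \<and> \<not> (\<exists>d\<in>T. strictly_above d c)"

text \<open>The root is never an arrow, so it is a dot of every fb-tableau.\<close>

definition is_dot :: "nat \<Rightarrow> cell set \<Rightarrow> cell \<Rightarrow> bool" where
  "is_dot n T c \<longleftrightarrow> c \<in> T \<and> \<not> left_arrow n T c \<and> \<not> up_arrow n T c"

definition free_cell :: "nat \<Rightarrow> cell set \<Rightarrow> cell \<Rightarrow> bool" where
  "free_cell n T c \<longleftrightarrow> c \<in> board n \<and>
     (\<exists>d. up_arrow n T d \<and> strictly_above d c) \<and> (\<exists>d. left_arrow n T d \<and> strictly_left d c)"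

definition Row :: "nat \<Rightarrow> cell set \<Rightarrow> cell set" where
  "Row n T = {c \<in> board n. \<exists>d. (left_arrow n T d \<or> d = root_cell n) \<and> (d = c \<or> strictly_left d c)}"

definition Col :: "nat \<Rightarrow> cell set \<Rightarrow> cell set" where
  "Col n T = {c \<in> board n. \<exists>d. (up_arrow n T d \<or> d = root_cell n) \<and> (d = c \<or> strictly_above d c)}"

definition fb_le :: "nat \<Rightarrow> cell set \<Rightarrow> cell set \<Rightarrow> bool" where
  "fb_le n S T \<longleftrightarrow>
     Col n S \<subseteq> Col n T \<and> Row n T \<subseteq> Row n S \<and>
     (\<forall>c. free_cell n S c \<and> free_cell n T c \<and> is_dot n S c \<longrightarrow> is_dot n T c)"

definition small :: "nat \<Rightarrow> cell set \<Rightarrow> bool" where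
  "small n T \<longleftrightarrow> {c. is_dot n T c} = {root_cell n}"

definition sTam :: "nat \<Rightarrow> cell set gorder" where
  "sTam n = \<lparr>carrier = {T. fb_tableau n T \<and> small n T}, eq = (=), le = fb_le n\<rparr>"

definition lattice_congruence :: "('a, 'b) gorder_scheme \<Rightarrow> ('a \<times> 'a) set \<Rightarrow> bool" where
  "lattice_congruence L r \<longleftrightarrow>
     equiv (carrier L) r \<and>
     (\<forall>(a, b)\<in>r. \<forall>(c, d)\<in>r. (a \<sqinter>\<^bsub>L\<^esub> c, b \<sqinter>\<^bsub>L\<^esub> d) \<in> r \<and> (a \<squnion>\<^bsub>L\<^esub> c, b \<squnion>\<^bsub>L\<^esub> d) \<in> r)"

definition congruence_lattice :: "('a, 'b) gorder_scheme \<Rightarrow> ('a \<times> 'a) set gorder" where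
  "congruence_lattice L = \<lparr>carrier = {r. lattice_congruence L r}, eq = (=), le = (\<subseteq>)\<rparr>"

definition num_congruences :: "nat \<Rightarrow> nat" where
  "num_congruences n = (if n = 0 then 1 else card (carrier (congruence_lattice (sTam n))))"

definition congruences_gf :: "real fps" where
  "congruences_gf = Abs_fps (\<lambda>n. of_nat (num_congruences n))"

text \<open>
  \<open>fps_radical root 2\<close> takes the square root of a power series; for a radicand with constant term
  \<open>1\<close> it is the one with constant term \<open>root 2 1 = 1\<close>. The numerator has constant term \<open>0\<close>, so
  the division by \<open>2x\<close> is exact.
\<close>

definition N_fps :: "real \<Rightarrow> real fps" where
  "N_fps l =
     (1 + fps_X - fps_const l * fps_X
        - fps_radical root 2 (1 - fps_const (2 * (l + 1)) * fps_X + fps_const ((l - 1)^2) * fps_X^2))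
     / (2 * fps_X)"

text \<open>
  \<open>cf_tail k\<close> is the denominator \<open>1 + x - 4x / (1 + x - 4x / \<dots>)\<close> at the third level of the
  continued fraction, cut off after \<open>k\<close> further levels.
  Convergence of these series is that of the library's topology on \<open>fps\<close>: every coefficient is
  eventually constant, see \<open>tendsto_fps_iff\<close>.
\<close>

primrec cf_tail :: "nat \<Rightarrow> real fps" where
  "cf_tail 0 = 1 + fps_X"
| "cf_tail (Suc k) = 1 + fps_X - (4 * fps_X) / cf_tail k"

definition cf_truncation :: "nat \<Rightarrow> real fps" where
  "cf_truncation k = 1 / (1 - fps_X / (1 - fps_X / cf_tail k))"

end

theory Submission
  imports Defs
begin

text \<open>
  A small fb-tableau is determined by one number per \<open>k \<in> {1..<n}\<close>, a pointer \<open>t k \<in> {0..n} - {k}\<close>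
  that records both the up-arrow of column \<open>k\<close> and the left-arrow of row \<open>k + 1\<close>; the order
  becomes the reversed pointwise order. In the pointwise order there is one join-irreducible
  \<open>e j\<close>, with lower cover \<open>d j\<close>, for each label \<open>j \<in> {1..<n}\<^sup>2\<close>, and a congruence is determined by
  the set \<open>X\<close> of labels it contracts: \<open>a\<close> and \<open>b\<close> are congruent iff the same labels outside \<open>X\<close>
  lie below them. This relation always respects meets. It respects joins as well iff \<open>X\<close> satisfies a
  local closure condition, because then it has the dual description obtained from the
  anti-automorphism \<open>k \<mapsto> n - k\<close>.

  Read along its diagonals \<open>{p, q}\<close> with \<open>q - p\<close> constant, a closed set \<open>X\<close> is a triangular array
  with four states per cell in which a cell of the next diagonal is forced to be full or is free,
  depending on the two cells next to it. A full cell makes everything above it full, so it splits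
  the array into two independent ones. Cutting each of the first diagonals at its full cells yields
  \<open>N (1 + x - 4xN) = 1\<close>, \<open>A (1 - xN) = 1\<close> and \<open>F (1 - xA) = 1\<close>.
\<close>

section \<open>Congruences and contracted labels\<close>

lemma lattice_congruence_inv_gorder [simp]:
  "lattice_congruence (inv_gorder L) r \<longleftrightarrow> lattice_congruence L r"
  unfolding lattice_congruence_def by auto

section \<open>Transport of congruences along order isomorphisms\<close>

text \<open>Joins and meets of \<open>L\<close> are Hilbert choices, while \<open>M\<close> is known
  to be a lattice. An order isomorphism carries upper and lower bounds over, so the bounds chosen in
  \<open>L\<close> are the images of those in \<open>M\<close>, and \<open>map_prod f f\<close>
  matches the congruences.\<close>

lemma card_congruences_iso:
  fixes L :: "('a, 'c) gorder_scheme" and M :: "('b, 'd) gorder_scheme"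
  assumes M: "lattice M"
    and bij: "bij_betw f (carrier M) (carrier L)"
    and le: "\<And>a b. a \<in> carrier M \<Longrightarrow> b \<in> carrier M \<Longrightarrow> f a \<sqsubseteq>\<^bsub>L\<^esub> f b \<longleftrightarrow> a \<sqsubseteq>\<^bsub>M\<^esub> b"
  shows "card {r. lattice_congruence L r} = card {r. lattice_congruence M r}"
proof -
  interpret M: lattice M by fact
  have inj: "inj_on f (carrier M)" and im: "f ` carrier M = carrier L"
    using bij by (auto simp: bij_betw_def)
  have up: "Upper L {f a, f b} = f ` Upper M {a, b}"
    if "a \<in> carrier M" "b \<in> carrier M" for a b
    unfolding Upper_def im[symmetric] using that le by auto
  have lo: "Lower L {f a, f b} = f ` Lower M {a, b}"
    if "a \<in> carrier M" "b \<in> carrier M" for a b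
    unfolding Lower_def im[symmetric] using that le by auto
  have join: "f a \<squnion>\<^bsub>L\<^esub> f b = f (a \<squnion>\<^bsub>M\<^esub> b)" if ab: "a \<in> carrier M" "b \<in> carrier M" for a b
    unfolding join_def[of L] sup_def[of L]
  proof (rule some_equality)
    let ?j = "a \<squnion>\<^bsub>M\<^esub> b"
    have lst: "least M ?j (Upper M {a, b})"
      unfolding join_def using ab by (rule M.sup_of_two_least)
    have sub: "Upper M {a, b} \<subseteq> carrier M" by (rule Upper_closed)
    have jU: "?j \<in> Upper M {a, b}" using lst by (rule least_mem)
    have jle: "\<And>u. u \<in> Upper M {a, b} \<Longrightarrow> ?j \<sqsubseteq>\<^bsub>M\<^esub> u" using lst by (auto simp: least_def)
    have "f ?j \<sqsubseteq>\<^bsub>L\<^esub> f u" if "u \<in> Upper M {a, b}" for u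
      using that jle[OF that] le jU sub by (meson subsetD)
    moreover have "f ` Upper M {a, b} \<subseteq> carrier L" using image_mono[OF sub, of f] im by simp
    ultimately show "least L (f ?j) (Upper L {f a, f b})"
      unfolding least_def up[OF ab] using jU by simp
    \<comment> \<open>Uniqueness is pulled back along \<open>f\<close>, where antisymmetry of
      \<open>M\<close> is available.\<close>
    fix x assume "least L x (Upper L {f a, f b})"
    then have x: "x \<in> f ` Upper M {a, b}" "\<And>u. u \<in> Upper M {a, b} \<Longrightarrow> x \<sqsubseteq>\<^bsub>L\<^esub> f u"
      unfolding least_def up[OF ab] by auto
    then obtain y where y: "y \<in> Upper M {a, b}" "x = f y" by auto
    then have "y \<sqsubseteq>\<^bsub>M\<^esub> ?j" using x(2)[OF jU] le sub jU by (metis subsetD)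
    then show "x = f ?j" using jle[OF y(1)] y sub jU M.le_antisym by (metis subsetD)
  qed
  have meet: "f a \<sqinter>\<^bsub>L\<^esub> f b = f (a \<sqinter>\<^bsub>M\<^esub> b)" if ab: "a \<in> carrier M" "b \<in> carrier M" for a b
    unfolding meet_def[of L] inf_def[of L]
  proof (rule some_equality)
    let ?j = "a \<sqinter>\<^bsub>M\<^esub> b"
    have lst: "greatest M ?j (Lower M {a, b})"
      unfolding meet_def using ab by (rule M.inf_of_two_greatest)
    have sub: "Lower M {a, b} \<subseteq> carrier M" by (rule Lower_closed)
    have jU: "?j \<in> Lower M {a, b}" using lst by (rule greatest_mem)
    have jle: "\<And>u. u \<in> Lower M {a, b} \<Longrightarrow> u \<sqsubseteq>\<^bsub>M\<^esub> ?j" using lst by (auto simp: greatest_def)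
    have "f u \<sqsubseteq>\<^bsub>L\<^esub> f ?j" if "u \<in> Lower M {a, b}" for u
      using that jle[OF that] le jU sub by (meson subsetD)
    moreover have "f ` Lower M {a, b} \<subseteq> carrier L" using image_mono[OF sub, of f] im by simp
    ultimately show "greatest L (f ?j) (Lower L {f a, f b})"
      unfolding greatest_def lo[OF ab] using jU by simp
    fix x assume "greatest L x (Lower L {f a, f b})"
    then have x: "x \<in> f ` Lower M {a, b}" "\<And>u. u \<in> Lower M {a, b} \<Longrightarrow> f u \<sqsubseteq>\<^bsub>L\<^esub> x"
      unfolding greatest_def lo[OF ab] by auto
    then obtain y where y: "y \<in> Lower M {a, b}" "x = f y" by auto
    then have "?j \<sqsubseteq>\<^bsub>M\<^esub> y" using x(2)[OF jU] le sub jU by (metis subsetD)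
    then show "x = f ?j" using jle[OF y(1)] y sub jU M.le_antisym by (metis subsetD)
  qed
  define g where "g = map_prod f f"
  have inj_g: "inj_on g (carrier M \<times> carrier M)"
    unfolding g_def using inj by (auto simp: inj_on_def)
  have g_im: "g ` (carrier M \<times> carrier M) = carrier L \<times> carrier L"
    unfolding g_def im[symmetric] by (simp add: map_prod_surj_on)
  have key: "lattice_congruence L (g ` r) \<longleftrightarrow> lattice_congruence M r"
    if r: "r \<subseteq> carrier M \<times> carrier M" for r
  proof -
    have g: "(f a, f b) \<in> g ` r \<longleftrightarrow> (a, b) \<in> r" if "a \<in> carrier M" "b \<in> carrier M" for a b
    proof
      assume "(f a, f b) \<in> g ` r"
      then obtain p where p: "p \<in> r" "g p = g (a, b)" unfolding g_def by auto
      then have "p = (a, b)" using inj_onD[OF inj_g] that r by blast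
      then show "(a, b) \<in> r" using p by simp
    qed (force simp: g_def)
    have mem: "(x, y) \<in> g ` r \<longleftrightarrow> (\<exists>a b. (a, b) \<in> r \<and> x = f a \<and> y = f b)" for x y
      unfolding g_def by auto
    have gr: "g ` r \<subseteq> carrier L \<times> carrier L" using image_mono[OF r, of g] g_im by simp
    have refl: "refl_on (carrier L) (g ` r) \<longleftrightarrow> refl_on (carrier M) r"
      unfolding refl_on_def im[symmetric] using g by auto
    have sym: "sym (g ` r) \<longleftrightarrow> sym r"
    proof
      assume a: "sym (g ` r)"
      show "sym r"
      proof (rule symI)
        fix a b assume ab: "(a, b) \<in> r"
        then have c: "a \<in> carrier M" "b \<in> carrier M" using r by auto
        then have "(f b, f a) \<in> g ` r" using a g ab symD by metis
        then show "(b, a) \<in> r" using g c by blast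
      qed
    next
      assume "sym r" then show "sym (g ` r)"
        unfolding sym_def mem by blast
    qed
    have trans: "trans (g ` r) \<longleftrightarrow> trans r"
    proof
      assume a: "trans (g ` r)"
      show "trans r"
      proof (rule transI)
        fix a b c assume ab: "(a, b) \<in> r" "(b, c) \<in> r"
        then have c: "a \<in> carrier M" "b \<in> carrier M" "c \<in> carrier M" using r by auto
        then have "(f a, f c) \<in> g ` r" using transD[OF a] g ab by metis
        then show "(a, c) \<in> r" using g c by blast
      qed
    next
      assume t: "trans r" show "trans (g ` r)"
      proof (rule transI)
        fix x y z assume "(x, y) \<in> g ` r" "(y, z) \<in> g ` r"
        then obtain a b b' c where abc: "(a, b) \<in> r" "(b', c) \<in> r"
          and eq: "x = f a" "y = f b" "y = f b'" "z = f c" unfolding mem by blast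
        have "b \<in> carrier M" "b' \<in> carrier M" using abc r by auto
        then have "b = b'" using inj_onD[OF inj, of b b'] eq by simp
        then have "(a, c) \<in> r" using abc transD[OF t] by blast
        then show "(x, z) \<in> g ` r" using eq unfolding mem by blast
      qed
    qed
    have compat: "(\<forall>(a, b)\<in>g ` r. \<forall>(c, d)\<in>g ` r.
        (a \<sqinter>\<^bsub>L\<^esub> c, b \<sqinter>\<^bsub>L\<^esub> d) \<in> g ` r \<and> (a \<squnion>\<^bsub>L\<^esub> c, b \<squnion>\<^bsub>L\<^esub> d) \<in> g ` r)
      \<longleftrightarrow> (\<forall>(a, b)\<in>r. \<forall>(c, d)\<in>r.
        (a \<sqinter>\<^bsub>M\<^esub> c, b \<sqinter>\<^bsub>M\<^esub> d) \<in> r \<and> (a \<squnion>\<^bsub>M\<^esub> c, b \<squnion>\<^bsub>M\<^esub> d) \<in> r)"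
      (is "?l \<longleftrightarrow> ?r")
    proof -
      have "?l \<longleftrightarrow> (\<forall>(a, b)\<in>r. \<forall>(c, d)\<in>r.
        (f a \<sqinter>\<^bsub>L\<^esub> f c, f b \<sqinter>\<^bsub>L\<^esub> f d) \<in> g ` r \<and> (f a \<squnion>\<^bsub>L\<^esub> f c, f b \<squnion>\<^bsub>L\<^esub> f d) \<in> g ` r)"
        unfolding g_def by (simp add: case_prod_unfold)
      also have "\<dots> \<longleftrightarrow> ?r"
      proof -
        have "(f a \<sqinter>\<^bsub>L\<^esub> f c, f b \<sqinter>\<^bsub>L\<^esub> f d) \<in> g ` r \<and> (f a \<squnion>\<^bsub>L\<^esub> f c, f b \<squnion>\<^bsub>L\<^esub> f d) \<in> g ` r \<longleftrightarrow>
          (a \<sqinter>\<^bsub>M\<^esub> c, b \<sqinter>\<^bsub>M\<^esub> d) \<in> r \<and> (a \<squnion>\<^bsub>M\<^esub> c, b \<squnion>\<^bsub>M\<^esub> d) \<in> r"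
          if "(a, b) \<in> r" "(c, d) \<in> r" for a b c d
        proof -
          have "a \<in> carrier M" "b \<in> carrier M" "c \<in> carrier M" "d \<in> carrier M"
            using that r by auto
          then show ?thesis by (simp add: join meet g)
        qed
        then show ?thesis by fast
      qed
      finally show ?thesis .
    qed
    show ?thesis
      unfolding lattice_congruence_def equiv_def refl sym trans compat using r gr by auto
  qed
  have sub: "lattice_congruence N r \<Longrightarrow> r \<subseteq> carrier N \<times> carrier N" for N :: "('x, 'y) gorder_scheme" and r
    unfolding lattice_congruence_def equiv_def by auto
  have "bij_betw ((`) g) {r. lattice_congruence M r} {r. lattice_congruence L r}"
  proof (rule bij_betwI')
    fix r s assume "r \<in> {r. lattice_congruence M r}" "s \<in> {r. lattice_congruence M r}"
    then show "(g ` r = g ` s) = (r = s)"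
      using inj_on_image_eq_iff[OF inj_g sub sub] by simp
  next
    fix r assume "r \<in> {r. lattice_congruence M r}"
    then show "g ` r \<in> {r. lattice_congruence L r}" using key[OF sub] by simp
  next
    fix s assume s: "s \<in> {r. lattice_congruence L r}"
    then have "s \<subseteq> g ` (carrier M \<times> carrier M)" using g_im sub[of L s] by simp
    then obtain r where "r \<subseteq> carrier M \<times> carrier M" "s = g ` r"
      by (auto simp: subset_image_iff)
    then show "\<exists>r\<in>{r. lattice_congruence M r}. s = g ` r" using key s by auto
  qed
  then show ?thesis using bij_betw_same_card by metis
qed

section \<open>Finite lattices described by labels of join-irreducibles\<close>

text \<open>\<open>J x\<close> collects the labels of the join-irreducibles \<open>e j\<close> below
  \<open>x\<close>, and \<open>d j\<close> is the unique lower cover of \<open>e j\<close>: an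
  element strictly below \<open>e j\<close> misses the label \<open>j\<close>, so it lies below
  \<open>d j\<close>.\<close>

locale labelled_lattice = lattice L for L :: "('a, 'c) gorder_scheme" (structure) +
  fixes labels :: "'l set" and J :: "'a \<Rightarrow> 'l set" and e d :: "'l \<Rightarrow> 'a"
  assumes finite_labels: "finite labels"
    and J_sub: "x \<in> carrier L \<Longrightarrow> J x \<subseteq> labels"
    and le_iff: "x \<in> carrier L \<Longrightarrow> y \<in> carrier L \<Longrightarrow> x \<sqsubseteq> y \<longleftrightarrow> J x \<subseteq> J y"
    and e_closed: "j \<in> labels \<Longrightarrow> e j \<in> carrier L"
    and d_closed: "j \<in> labels \<Longrightarrow> d j \<in> carrier L"
    and J_iff: "j \<in> labels \<Longrightarrow> x \<in> carrier L \<Longrightarrow> j \<in> J x \<longleftrightarrow> e j \<sqsubseteq> x"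
    and J_d: "j \<in> labels \<Longrightarrow> J (d j) = J (e j) - {j}"
begin

definition label_kernel :: "'l set \<Rightarrow> ('a \<times> 'a) set" where
  "label_kernel X = {(x, y). x \<in> carrier L \<and> y \<in> carrier L \<and> J x - X = J y - X}"

definition contracted :: "('a \<times> 'a) set \<Rightarrow> 'l set" where
  "contracted r = {j \<in> labels. (e j, d j) \<in> r}"

lemma J_meet:
  assumes "x \<in> carrier L" "y \<in> carrier L"
  shows "J (x \<sqinter> y) = J x \<inter> J y"
proof -
  have c: "x \<sqinter> y \<in> carrier L" using assms by simp
  have "j \<in> J (x \<sqinter> y) \<longleftrightarrow> j \<in> J x \<and> j \<in> J y" if "j \<in> labels" for j
    using that assms c e_closed[OF that] J_iff meet_le meet_left meet_right le_trans by metis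
  then show ?thesis using J_sub assms c by blast
qed

lemma J_e: "j \<in> labels \<Longrightarrow> j \<in> J (e j)"
  using J_iff e_closed by simp

lemma d_le_e: "j \<in> labels \<Longrightarrow> d j \<sqsubseteq> e j"
  using le_iff[OF d_closed e_closed] J_d by auto

lemma J_inj: "x \<in> carrier L \<Longrightarrow> y \<in> carrier L \<Longrightarrow> J x = J y \<Longrightarrow> x = y"
  using le_iff le_antisym by simp

lemma equiv_kernel: "equiv (carrier L) (label_kernel X)"
  unfolding label_kernel_def equiv_def refl_on_def sym_def trans_def by auto

lemma kernel_meet:
  assumes "(x, y) \<in> label_kernel X" "(x', y') \<in> label_kernel X"
  shows "(x \<sqinter> x', y \<sqinter> y') \<in> label_kernel X"
  using assms unfolding label_kernel_def by (auto simp: J_meet)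

text \<open>Meeting with \<open>e j\<close> and then joining with \<open>d j\<close> turns a
  congruent pair into \<open>(d j, e j)\<close> for each label \<open>j\<close> of the difference.
  Conversely, one climbs from \<open>x\<close> to \<open>y\<close> by joining one \<open>e j\<close>
  at a time, never leaving the class.\<close>

lemma congruence_iff_below:
  assumes r: "lattice_congruence L r" and xy: "x \<in> carrier L" "y \<in> carrier L" "x \<sqsubseteq> y"
  shows "(x, y) \<in> r \<longleftrightarrow> J y - J x \<subseteq> contracted r"
proof
  have eq: "equiv (carrier L) r" using r unfolding lattice_congruence_def by simp
  have refl: "(z, z) \<in> r" if "z \<in> carrier L" for z
    using eq that unfolding equiv_def refl_on_def by auto
  have sym: "(b, a) \<in> r" if "(a, b) \<in> r" for a b
    using eq that unfolding equiv_def sym_def by auto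
  have tr: "(a, c) \<in> r" if "(a, b) \<in> r" "(b, c) \<in> r" for a b c
    using eq that unfolding equiv_def trans_def by blast
  have me: "(a \<sqinter> c, b \<sqinter> c') \<in> r" and jo: "(a \<squnion> c, b \<squnion> c') \<in> r"
    if "(a, b) \<in> r" "(c, c') \<in> r" for a b c c'
    using r that unfolding lattice_congruence_def by auto
  {
    assume xyr: "(x, y) \<in> r"
    show "J y - J x \<subseteq> contracted r"
    proof
      fix j assume j: "j \<in> J y - J x"
      then have jl: "j \<in> labels" using J_sub xy by auto
      note ec = e_closed[OF jl] and dc = d_closed[OF jl]
      have 1: "(e j \<sqinter> x, e j \<sqinter> y) \<in> r" using me refl[OF ec] xyr by blast
      have 2: "e j \<sqinter> y = e j"
        by (rule J_inj) (use J_meet ec xy j jl J_iff le_iff in auto)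
      have 3: "e j \<sqinter> x \<sqsubseteq> d j"
        by (subst le_iff) (use J_meet J_d ec dc xy jl j in auto)
      have 4: "d j \<squnion> (e j \<sqinter> x) = d j"
        using 3 ec dc xy by (meson join_closed join_le join_left le_antisym le_refl meet_closed)
      have 5: "d j \<squnion> e j = e j"
        using d_le_e[OF jl] ec dc by (meson join_closed join_le join_right le_antisym le_refl)
      have "(d j \<squnion> (e j \<sqinter> x), d j \<squnion> e j) \<in> r"
        using jo[OF refl[OF dc]] 1 2 by simp
      then have "(d j, e j) \<in> r" using 4 5 by simp
      then show "j \<in> contracted r" unfolding contracted_def using jl sym by simp
    qed
  }
  have "x \<sqsubseteq> y \<Longrightarrow> J y - J x \<subseteq> contracted r \<Longrightarrow> x \<in> carrier L \<Longrightarrow> (x, y) \<in> r"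
  proof (induction "card (J y - J x)" arbitrary: x rule: less_induct)
    case less
    have fin: "finite (J y - J x)" using J_sub[OF xy(2)] finite_labels finite_subset by blast
    show ?case
    proof (cases "J y - J x = {}")
      case True
      then have "x = y" using less.prems le_iff xy(2) by (intro J_inj) auto
      then show ?thesis using refl xy by simp
    next
      case False
      \<comment> \<open>With \<open>J (e j)\<close> of least size, all other labels of
        \<open>e j\<close> already belong to \<open>x\<close>, so \<open>d j\<close> lies below
        \<open>x\<close>.\<close>
      obtain j where j: "j \<in> J y - J x"
        and jmin: "\<And>i. i \<in> J y - J x \<Longrightarrow> card (J (e j)) \<le> card (J (e i))"
        using ex_has_least_nat[of "\<lambda>j. j \<in> J y - J x" _ "\<lambda>j. card (J (e j))"] False by blast
      have jl: "j \<in> labels" using j J_sub xy by auto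
      note ec = e_closed[OF jl] and dc = d_closed[OF jl]
      have ejy: "e j \<sqsubseteq> y" using j J_iff jl xy by auto
      have "J (d j) \<subseteq> J x"
      proof
        fix i assume i: "i \<in> J (d j)"
        then have il: "i \<in> labels" using J_sub dc by auto
        have ij: "i \<in> J (e j)" "i \<noteq> j" using i J_d jl by auto
        have iy: "i \<in> J y" using ij ejy le_iff ec xy by auto
        have sub: "J (e i) \<subseteq> J (e j)" using ij il J_iff e_closed le_iff ec by blast
        \<comment> \<open>Equality would put \<open>e j\<close> below \<open>d j\<close>, because
          \<open>i\<close> is a label of \<open>d j\<close>.\<close>
        have "J (e i) \<noteq> J (e j)"
        proof
          assume "J (e i) = J (e j)"
          then have "e j \<sqsubseteq> d j"
            using i il dc ec J_iff[OF il dc] e_closed[OF il] le_iff by auto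
          then show False using J_iff[OF jl dc] J_d[OF jl] by auto
        qed
        then have "card (J (e i)) < card (J (e j))"
          using sub J_sub[OF ec] finite_labels by (meson finite_subset psubset_card_mono psubsetI)
        then show "i \<in> J x" using jmin iy by fastforce
      qed
      then have djx: "d j \<sqsubseteq> x" using le_iff dc less.prems by simp
      let ?z = "x \<squnion> e j"
      have zc: "?z \<in> carrier L" using less.prems ec by simp
      have "x \<squnion> d j = x"
        using djx dc less.prems by (meson join_closed join_le join_left le_antisym le_refl)
      moreover have "(x \<squnion> d j, ?z) \<in> r"
        using j less.prems(2) sym refl less.prems(3) unfolding contracted_def by (intro jo) auto
      ultimately have xz: "(x, ?z) \<in> r" by simp
      have zy: "?z \<sqsubseteq> y" using ejy less.prems ec xy by (simp add: join_le)
      have Jz: "J x \<subseteq> J ?z" "j \<in> J ?z"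
        using less.prems ec zc jl J_iff le_iff by (auto simp: join_left join_right simp flip: le_iff)
      then have "J y - J ?z \<subset> J y - J x" using j by auto
      then have "card (J y - J ?z) < card (J y - J x)" using fin by (rule psubset_card_mono[rotated])
      then have "(?z, y) \<in> r" using less.hyps zy zc Jz less.prems by blast
      then show ?thesis using xz tr by blast
    qed
  qed
  then show "J y - J x \<subseteq> contracted r \<Longrightarrow> (x, y) \<in> r" using xy by blast
qed

text \<open>Reduction to comparable pairs: two elements are congruent iff both are congruent to
  their meet, whose labels are the common ones.\<close>

lemma congruence_eq_kernel:
  assumes r: "lattice_congruence L r"
  shows "r = label_kernel (contracted r)"
proof -
  have eq: "equiv (carrier L) r" using r unfolding lattice_congruence_def by simp
  have "(x, y) \<in> r \<longleftrightarrow> (x, y) \<in> label_kernel (contracted r)"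
    if xy: "x \<in> carrier L" "y \<in> carrier L" for x y
  proof -
    let ?m = "x \<sqinter> y"
    have m: "?m \<in> carrier L" "?m \<sqsubseteq> x" "?m \<sqsubseteq> y" using xy by (auto simp: meet_left meet_right)
    have idem: "z \<sqinter> z = z" if "z \<in> carrier L" for z
      using that by (intro J_inj) (simp_all add: J_meet)
    have sub: "(x, y) \<in> r \<longleftrightarrow> (?m, x) \<in> r \<and> (?m, y) \<in> r"
    proof
      assume a: "(x, y) \<in> r"
      have rx: "(x, x) \<in> r" and ry: "(y, y) \<in> r" and yx: "(y, x) \<in> r"
        using eq xy a unfolding equiv_def refl_on_def sym_def by auto
      have "(u \<sqinter> v, u' \<sqinter> v') \<in> r" if "(u, u') \<in> r" "(v, v') \<in> r" for u u' v v'
        using r that unfolding lattice_congruence_def by auto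
      then have "(x \<sqinter> y, x \<sqinter> x) \<in> r" "(x \<sqinter> y, y \<sqinter> y) \<in> r"
        using rx ry yx a by auto
      then show "(?m, x) \<in> r \<and> (?m, y) \<in> r" using idem xy by simp
    next
      assume "(?m, x) \<in> r \<and> (?m, y) \<in> r"
      then show "(x, y) \<in> r" using eq unfolding equiv_def by (meson symD transD)
    qed
    also have "\<dots> \<longleftrightarrow> (J x - J ?m \<subseteq> contracted r) \<and> (J y - J ?m \<subseteq> contracted r)"
      using congruence_iff_below[OF r] xy m by simp
    also have "\<dots> \<longleftrightarrow> (x, y) \<in> label_kernel (contracted r)"
      unfolding label_kernel_def using xy by (simp add: J_meet) blast
    finally show ?thesis .
  qed
  moreover have "r \<subseteq> carrier L \<times> carrier L" using eq unfolding equiv_def by auto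
  moreover have "label_kernel (contracted r) \<subseteq> carrier L \<times> carrier L" unfolding label_kernel_def by auto
  ultimately show ?thesis by (intro equalityI subrelI) blast+
qed

lemma contracted_kernel:
  assumes "X \<subseteq> labels"
  shows "contracted (label_kernel X) = X"
  unfolding contracted_def label_kernel_def
  using assms e_closed d_closed J_d J_e by auto

text \<open>A congruence and its set of contracted labels determine each other. As label kernels
  always respect meets, what remains is to decide which of them respect joins.\<close>

lemma card_congruences:
  "card {r. lattice_congruence L r} = card {X. X \<subseteq> labels \<and> lattice_congruence L (label_kernel X)}"
proof (rule bij_betw_same_card)
  show "bij_betw contracted {r. lattice_congruence L r}
    {X. X \<subseteq> labels \<and> lattice_congruence L (label_kernel X)}"
  proof (rule bij_betw_byWitness[where f' = label_kernel])
    show "\<forall>r\<in>{r. lattice_congruence L r}. label_kernel (contracted r) = r"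
      using congruence_eq_kernel by simp
    show "\<forall>X\<in>{X. X \<subseteq> labels \<and> lattice_congruence L (label_kernel X)}. contracted (label_kernel X) = X"
      using contracted_kernel by simp
    show "contracted ` {r. lattice_congruence L r}
        \<subseteq> {X. X \<subseteq> labels \<and> lattice_congruence L (label_kernel X)}"
    proof
      fix X assume "X \<in> contracted ` {r. lattice_congruence L r}"
      then obtain r where r: "X = contracted r" "lattice_congruence L r" by auto
      then have "lattice_congruence L (label_kernel X)" using congruence_eq_kernel[OF r(2)] by simp
      moreover have "X \<subseteq> labels" using r unfolding contracted_def by auto
      ultimately show "X \<in> {X. X \<subseteq> labels \<and> lattice_congruence L (label_kernel X)}" by simp
    qed
    show "label_kernel ` {X. X \<subseteq> labels \<and> lattice_congruence L (label_kernel X)} \<subseteq> {r. lattice_congruence L r}"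
      by auto
  qed
qed

end

section \<open>Pointers\<close>

text \<open>
  \<open>k < t k\<close>: the border cell \<open>(k + 1, k)\<close> is an up-arrow and the left-arrow of row \<open>k + 1\<close> is in
  column \<open>t k\<close>. \<open>t k < k\<close>: the border cell is a left-arrow and the up-arrow of column \<open>k\<close> is in row
  \<open>t k + 1\<close>. The last two conditions say that an arrow has a nonempty cell above it or to its left.
\<close>
definition pointers :: "nat \<Rightarrow> (nat \<Rightarrow> nat) set" where
  "pointers n = {t. (\<forall>k. k \<notin> {1..<n} \<longrightarrow> t k = 0) \<and>
     (\<forall>k\<in>{1..<n}. t k \<le> n \<and> t k \<noteq> k \<and> (k < t k \<and> t k < n \<longrightarrow> t (t k) < k) \<and>
        (0 < t k \<and> t k < k \<longrightarrow> k < t (t k)))}"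

definition pointer_lattice :: "nat \<Rightarrow> (nat \<Rightarrow> nat) gorder" where
  "pointer_lattice n = \<lparr>carrier = pointers n, eq = (=), le = (\<le>)\<rparr>"

lemma pointer_lattice_simps [simp]:
  "carrier (pointer_lattice n) = pointers n" "eq (pointer_lattice n) = (=)"
  "le (pointer_lattice n) = (\<le>)"
  by (simp_all add: pointer_lattice_def)

lemma pointersI:
  assumes "\<And>k. k \<notin> {1..<n} \<Longrightarrow> t k = 0"
    and "\<And>k. 1 \<le> k \<Longrightarrow> k < n \<Longrightarrow> t k \<le> n \<and> t k \<noteq> k"
    and "\<And>k. 1 \<le> k \<Longrightarrow> k < n \<Longrightarrow> k < t k \<Longrightarrow> t k < n \<Longrightarrow> t (t k) < k"
    and "\<And>k. 1 \<le> k \<Longrightarrow> k < n \<Longrightarrow> 0 < t k \<Longrightarrow> t k < k \<Longrightarrow> k < t (t k)"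
  shows "t \<in> pointers n"
  using assms unfolding pointers_def by auto

lemma
  assumes "t \<in> pointers n"
  shows pointers_outside: "k \<notin> {1..<n} \<Longrightarrow> t k = 0"
    and pointers_le: "t k \<le> n"
    and pointers_neq: "1 \<le> k \<Longrightarrow> k < n \<Longrightarrow> t k \<noteq> k"
    and pointers_down: "1 \<le> k \<Longrightarrow> k < t k \<Longrightarrow> t k < n \<Longrightarrow> t (t k) < k"
    and pointers_up: "k < n \<Longrightarrow> 0 < t k \<Longrightarrow> t k < k \<Longrightarrow> k < t (t k)"
  using assms unfolding pointers_def
  by (cases "k \<in> {1..<n}"; force)+

section \<open>Meets, joins and reflection of pointers\<close>

text \<open>The pointwise minimum can violate the condition on values \<open>0 < t k < k\<close>.
  Lowering each value below its index to the largest admissible one repairs this and loses no common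
  lower bound.\<close>

lemma pointer_meet_exists:
  assumes a: "a \<in> pointers n" and b: "b \<in> pointers n"
  shows "\<exists>c\<in>pointers n. c \<le> a \<and> c \<le> b \<and> (\<forall>z\<in>pointers n. z \<le> a \<longrightarrow> z \<le> b \<longrightarrow> z \<le> c)"
proof -
  define m where "m k = min (a k) (b k)" for k
  \<comment> \<open>Candidates \<open>v\<close> for the repaired value at \<open>k\<close>. Testing
    \<open>m v\<close> instead of the repaired value at \<open>v\<close> is sound, since values
    above their index are kept.\<close>
  define P where "P k v \<longleftrightarrow> v \<le> m k \<and> (v = 0 \<or> k < m v)" for k v
  define c where "c k = (if k \<notin> {1..<n} then 0 else if k < m k then m k else (GREATEST v. P k v))" for k
  have bound: "P k v \<Longrightarrow> v \<le> m k" for k v unfolding P_def by simp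
  have P0: "P k 0" for k unfolding P_def by simp
  have G: "P k (GREATEST v. P k v)" for k
    by (rule GreatestI_nat[of "P k" 0 "m k"]) (use P0 bound in auto)
  have Gmax: "P k v \<Longrightarrow> v \<le> (GREATEST v. P k v)" for k v
    by (rule Greatest_le_nat[of "P k" v "m k"]) (use bound in auto)
  have m_le: "m k \<le> n" "m k \<le> a k" "m k \<le> b k" for k
    using pointers_le[OF a, of k] unfolding m_def by auto
  have m_ne: "m k \<noteq> k" if "k \<in> {1..<n}" for k
    using pointers_neq[OF a, of k] pointers_neq[OF b, of k] that unfolding m_def by auto
  have m_out: "m k = 0" if "k \<notin> {1..<n}" for k
    using pointers_outside[OF a that] unfolding m_def by simp
  have c_big: "c k = m k" if "k < m k" for k
    using that m_out[of k] unfolding c_def by auto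
  have c_small: "P k (c k)" "c k \<le> m k" if "\<not> k < m k" for k
    using that G[of k] bound[OF G[of k]] P0 unfolding c_def by auto
  have c_m: "c k \<le> m k" for k using c_big c_small by (cases "k < m k") auto
  have "c \<in> pointers n"
  proof (rule pointersI)
    show "c k = 0" if "k \<notin> {1..<n}" for k using that unfolding c_def by simp
  next
    fix k assume k: "1 \<le> k" "k < n"
    then show "c k \<le> n \<and> c k \<noteq> k"
      using c_m[of k] m_le(1)[of k] m_ne[of k] c_big[of k] by (cases "k < m k") auto
    {
      assume "k < c k" "c k < n"
      then have eq: "c k = m k" using c_m[of k] by (intro c_big) auto
      \<comment> \<open>Whichever of \<open>a\<close> and \<open>b\<close> attains the minimum at
        \<open>k\<close> also bounds \<open>m\<close> at the place \<open>m k\<close>.\<close>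
      have "m (m k) < k"
        using pointers_down[OF a, of k] pointers_down[OF b, of k] \<open>k < c k\<close> \<open>c k < n\<close> k
        unfolding eq by (auto simp: m_def min_def split: if_splits)
      then show "c (c k) < k" using c_m[of "c k"] eq by simp
    }
    {
      assume "0 < c k" "c k < k"
      then have "\<not> k < m k" using c_big[of k] by auto
      then have "k < m (c k)" using c_small(1)[of k] \<open>0 < c k\<close> unfolding P_def by auto
      then show "k < c (c k)" using c_big[of "c k"] \<open>c k < k\<close> by auto
    }
  qed
  moreover have "c \<le> a" "c \<le> b"
    using c_m m_le(2,3) by (meson le_fun_def order_trans)+
  moreover have "z \<le> c" if z: "z \<in> pointers n" "z \<le> a" "z \<le> b" for z
  proof (rule le_funI)
    fix k
    have zm: "z j \<le> m j" for j using z(2,3) unfolding m_def le_fun_def by simp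
    show "z k \<le> c k"
    proof (cases "k \<in> {1..<n}")
      case False
      then show ?thesis using pointers_outside[OF z(1)] by simp
    next
      case True
      show ?thesis
      proof (cases "k < m k")
        case True
        then show ?thesis using c_big zm by simp
      next
        case False
        \<comment> \<open>If \<open>0 < z k < k\<close>, then
          \<open>k < z (z k) \<le> m (z k)\<close>, so \<open>z k\<close> is a candidate.\<close>
        have "P k (z k)"
          unfolding P_def using zm[of k] zm[of "z k"] False True pointers_up[OF z(1), of k]
            pointers_neq[OF z(1), of k] by (cases "z k = 0") auto
        then show ?thesis using Gmax[of k "z k"] False True unfolding c_def by simp
      qed
    qed
  qed
  ultimately show ?thesis by blast
qed

text \<open>Positions and values are reversed at once; on pointers this is an order-reversing
  involution, so the pointer lattice is self-dual. The value 0 outside the index range is the one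
  \<open>pointers\<close> demands.\<close>

definition reflect :: "nat \<Rightarrow> (nat \<Rightarrow> nat) \<Rightarrow> nat \<Rightarrow> nat" where
  "reflect n t k = (if k \<in> {1..<n} then n - t (n - k) else 0)"

text \<open>Values above their index become values below it and 0 changes places with
  \<open>n\<close>, so the two conditions on iterated values are exchanged.\<close>

lemma reflect_pointers:
  assumes t: "t \<in> pointers n"
  shows "reflect n t \<in> pointers n"
proof (rule pointersI)
  show "reflect n t k = 0" if "k \<notin> {1..<n}" for k using that unfolding reflect_def by (rule if_not_P)
next
  fix k assume k: "1 \<le> k" "k < n"
  have r: "reflect n t k = n - t (n - k)" using k unfolding reflect_def by simp
  note le = pointers_le[OF t, of "n - k"]
  have le2: "t (t (n - k)) \<le> n" by (rule pointers_le[OF t])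
  have "t (n - k) \<noteq> n - k" by (rule pointers_neq[OF t]) (use k in auto)
  then show "reflect n t k \<le> n \<and> reflect n t k \<noteq> k" using r le k by linarith
  have rr: "reflect n t (reflect n t k) = n - t (t (n - k))"
    if "0 < reflect n t k" "reflect n t k < n"
  proof -
    have "n - reflect n t k = t (n - k)" using r le by simp
    then show ?thesis using that unfolding reflect_def[of n t "reflect n t k"] by simp
  qed
  {
    assume a: "k < reflect n t k" "reflect n t k < n"
    then have "n - k < t (t (n - k))"
      using r le k by (intro pointers_up[OF t]) auto
    then show "reflect n t (reflect n t k) < k" using rr a k by linarith
  }
  {
    assume a: "0 < reflect n t k" "reflect n t k < k"
    then have "t (t (n - k)) < n - k"
      using r le k by (intro pointers_down[OF t]) auto
    then show "k < reflect n t (reflect n t k)" using rr a k by linarith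
  }
qed

lemma reflect_reflect:
  assumes t: "t \<in> pointers n"
  shows "reflect n (reflect n t) = t"
proof
  fix k
  show "reflect n (reflect n t) k = t k"
    using pointers_le[OF t, of k] pointers_outside[OF t, of k]
    by (cases "k \<in> {1..<n}") (auto simp: reflect_def)
qed

lemma reflect_antimono: "s \<le> t \<Longrightarrow> reflect n t \<le> reflect n s"
  unfolding reflect_def le_fun_def by (auto intro: diff_le_mono2)

lemma le_reflect_iff:
  assumes "s \<in> pointers n" "t \<in> pointers n"
  shows "s \<le> reflect n t \<longleftrightarrow> t \<le> reflect n s"
  using assms reflect_antimono reflect_reflect by metis

text \<open>The join is the reflection of the meet of the reflections.\<close>

lemma pointer_join_exists:
  assumes a: "a \<in> pointers n" and b: "b \<in> pointers n"
  shows "\<exists>c\<in>pointers n. a \<le> c \<and> b \<le> c \<and> (\<forall>z\<in>pointers n. a \<le> z \<longrightarrow> b \<le> z \<longrightarrow> c \<le> z)"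
proof -
  obtain c where c: "c \<in> pointers n" "c \<le> reflect n a" "c \<le> reflect n b"
    and max: "\<And>z. z \<in> pointers n \<Longrightarrow> z \<le> reflect n a \<Longrightarrow> z \<le> reflect n b \<Longrightarrow> z \<le> c"
    using pointer_meet_exists[OF reflect_pointers[OF a] reflect_pointers[OF b]] by blast
  show ?thesis
  proof (intro bexI conjI ballI impI)
    show "reflect n c \<in> pointers n" using c reflect_pointers by blast
    show "a \<le> reflect n c" "b \<le> reflect n c" using le_reflect_iff a b c by blast+
    fix z assume z: "z \<in> pointers n" "a \<le> z" "b \<le> z"
    then have "reflect n z \<le> c" by (intro max reflect_pointers reflect_antimono)
    then show "reflect n c \<le> z" using reflect_antimono reflect_reflect[OF z(1)] by metis
  qed
qed

lemma lattice_pointers: "lattice (pointer_lattice n)"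
proof -
  interpret partial_order "pointer_lattice n"
    by unfold_locales (auto intro: order_trans)
  show ?thesis
  proof
    fix a b assume "a \<in> carrier (pointer_lattice n)" "b \<in> carrier (pointer_lattice n)"
    then have ab: "a \<in> pointers n" "b \<in> pointers n" by simp_all
    obtain c where "c \<in> pointers n" "a \<le> c" "b \<le> c"
      "\<And>z. z \<in> pointers n \<Longrightarrow> a \<le> z \<Longrightarrow> b \<le> z \<Longrightarrow> c \<le> z"
      using pointer_join_exists[OF ab] by blast
    then have "least (pointer_lattice n) c (Upper (pointer_lattice n) {a, b})"
      unfolding least_def Upper_def using ab by auto
    then show "\<exists>c. least (pointer_lattice n) c (Upper (pointer_lattice n) {a, b})" by blast
    obtain c where "c \<in> pointers n" "c \<le> a" "c \<le> b"
      "\<And>z. z \<in> pointers n \<Longrightarrow> z \<le> a \<Longrightarrow> z \<le> b \<Longrightarrow> z \<le> c"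
      using pointer_meet_exists[OF ab] by blast
    then have "greatest (pointer_lattice n) c (Lower (pointer_lattice n) {a, b})"
      unfolding greatest_def Lower_def using ab by auto
    then show "\<exists>c. greatest (pointer_lattice n) c (Lower (pointer_lattice n) {a, b})" by blast
  qed
qed

section \<open>Labels and join-irreducible pointers\<close>

definition labels :: "nat \<Rightarrow> (nat \<times> nat) set" where
  "labels n = {1..<n} \<times> {1..<n}"

text \<open>
  For \<open>p < q\<close>, the two labels \<open>(p, q)\<close> and \<open>(q, p)\<close> belong to the interval \<open>[p, q]\<close>; the label
  \<open>(p, p)\<close> plays both roles for \<open>[p, p]\<close>.
\<close>
definition label_set :: "nat \<Rightarrow> (nat \<Rightarrow> nat) \<Rightarrow> (nat \<times> nat) set" where
  "label_set n a = {(x, y) \<in> labels n. if x \<le> y then y < a x else y \<le> a x \<and> x < a y}"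

text \<open>The least pointer carrying the label. A value \<open>y < x\<close> at \<open>x\<close>
  is legal only if \<open>y\<close> points beyond \<open>x\<close>, whence the second entry
  \<open>Suc x\<close> at \<open>y\<close>.\<close>

definition join_irr :: "nat \<times> nat \<Rightarrow> nat \<Rightarrow> nat" where
  "join_irr = (\<lambda>(x, y). if x \<le> y then (\<lambda>_. 0)(x := Suc y) else (\<lambda>_. 0)(x := y, y := Suc x))"

text \<open>The entry of \<open>join_irr\<close> at \<open>x\<close> drops to the next legal value.
  For \<open>x = y\<close> this is 0, because \<open>x\<close> is forbidden at \<open>x\<close> and
  smaller nonzero values lack a partner; for \<open>y < x\<close> the partner at \<open>y\<close>
  survives.\<close>

definition join_irr_lower :: "nat \<times> nat \<Rightarrow> nat \<Rightarrow> nat" where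
  "join_irr_lower = (\<lambda>(x, y). if x = y then (\<lambda>_. 0) else if x < y then (\<lambda>_. 0)(x := y)
     else (\<lambda>_. 0)(y := Suc x))"

text \<open>A nonzero value is recovered from one label: \<open>(k, a k - 1)\<close> if
  \<open>k < a k\<close>, and \<open>(k, a k)\<close> if \<open>a k < k\<close>.\<close>

lemma label_set_le_iff:
  assumes a: "a \<in> pointers n" and b: "b \<in> pointers n"
  shows "a \<le> b \<longleftrightarrow> label_set n a \<subseteq> label_set n b"
proof
  assume "a \<le> b"
  then have "a k \<le> b k" for k by (simp add: le_fun_def)
  then show "label_set n a \<subseteq> label_set n b"
    unfolding label_set_def by (auto split: if_splits intro: order_trans less_le_trans)
next
  assume sub: "label_set n a \<subseteq> label_set n b"
  show "a \<le> b"
  proof (rule le_funI)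
    fix k
    show "a k \<le> b k"
    proof (cases "a k = 0")
      case False
      then have k: "1 \<le> k" "k < n" using pointers_outside[OF a, of k] by auto
      show ?thesis
      proof (cases "k < a k")
        case True
        then have "(k, a k - 1) \<in> label_set n a"
          using k pointers_le[OF a, of k] unfolding label_set_def labels_def by auto
        then have "(k, a k - 1) \<in> label_set n b" using sub by blast
        then show ?thesis using True unfolding label_set_def by (auto split: if_splits)
      next
        case f: False
        then have lt: "a k < k" using pointers_neq[OF a, of k] k by auto
        then have "(k, a k) \<in> label_set n a"
          using k False pointers_up[OF a, of k] unfolding label_set_def labels_def by auto
        then have "(k, a k) \<in> label_set n b" using sub by blast
        then show ?thesis using lt unfolding label_set_def by (auto split: if_splits)
      qed
    qed simp
  qed
qed

lemma join_irr_pointers: "j \<in> labels n \<Longrightarrow> join_irr j \<in> pointers n"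
  unfolding labels_def join_irr_def by (auto intro!: pointersI split: if_splits)

lemma join_irr_lower_pointers: "j \<in> labels n \<Longrightarrow> join_irr_lower j \<in> pointers n"
  unfolding labels_def join_irr_lower_def by (auto intro!: pointersI split: if_splits)

lemma label_set_iff:
  assumes "j \<in> labels n" "a \<in> pointers n"
  shows "j \<in> label_set n a \<longleftrightarrow> join_irr j \<le> a"
  using assms unfolding label_set_def join_irr_def le_fun_def
  by (cases j) (auto split: if_splits)

lemma label_set_join_irr_lower:
  assumes "j \<in> labels n"
  shows "label_set n (join_irr_lower j) = label_set n (join_irr j) - {j}"
  using assms unfolding label_set_def join_irr_def join_irr_lower_def labels_def
  by (cases j) (auto split: if_splits)

interpretation pointer_lattice:
  labelled_lattice "pointer_lattice n" "labels n" "label_set n" join_irr join_irr_lower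
  rewrites "carrier (pointer_lattice n) = pointers n" and "le (pointer_lattice n) = (\<le>)"
proof -
  interpret lattice "pointer_lattice n" by (rule lattice_pointers)
  show "labelled_lattice (pointer_lattice n) (labels n) (label_set n) join_irr join_irr_lower"
    by unfold_locales
      (simp_all add: label_set_le_iff join_irr_pointers join_irr_lower_pointers label_set_iff
        label_set_join_irr_lower, auto simp: labels_def label_set_def)
qed simp_all

section \<open>Closed sets of labels\<close>

text \<open>The local forcing rule from the intervals \<open>[p, q - 1]\<close> and
  \<open>[p + 1, q]\<close> to \<open>[p, q]\<close>. For subsets of \<open>labels n\<close> it
  turns out to be equivalent to the kernel of \<open>X\<close> being a congruence.\<close>

definition label_closed :: "nat \<Rightarrow> (nat \<times> nat) set \<Rightarrow> bool" where
  "label_closed n X \<longleftrightarrow> (\<forall>p q. 1 \<le> p \<and> p < q \<and> q < n \<and> ((p, q - 1) \<in> X \<or> (q, p + 1) \<in> X) \<longrightarrow>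
     (p, q) \<in> X \<and> (q, p) \<in> X)"

text \<open>The interval \<open>[p, q]\<close> goes to \<open>[n - q, n - p]\<close>, and the two
  labels of an interval change roles.\<close>

definition reflect_labels :: "nat \<Rightarrow> (nat \<times> nat) set \<Rightarrow> (nat \<times> nat) set" where
  "reflect_labels n X = {(x, y) \<in> labels n. (n - x, n - y) \<in> X}"

lemma label_closedD:
  assumes "label_closed n X" "1 \<le> p" "p < q" "q < n" "(p, q - 1) \<in> X \<or> (q, p + 1) \<in> X"
  shows "(p, q) \<in> X" "(q, p) \<in> X"
  using assms unfolding label_closed_def by blast+

text \<open>Forcing propagates: \<open>(q, v)\<close> forces \<open>(q, v - 1)\<close> and so on
  down to \<open>(q, p + 1)\<close>, which forces both labels of \<open>[p, q]\<close>.\<close>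

lemma label_closed_up:
  assumes X: "label_closed n X" and v: "(q, v) \<in> X" "1 \<le> p" "p < v" "v \<le> q" "q < n"
  shows "(p, q) \<in> X \<and> (q, p) \<in> X"
proof -
  have "(q, v - d) \<in> X \<or> d = 0" if "1 \<le> v - d" "d < v" for d
    using that
  proof (induction d)
    case (Suc d)
    have "(q, v - d) \<in> X" using Suc v(1) by (cases "d = 0") auto
    moreover have "v - d = (v - Suc d) + 1" using Suc.prems by simp
    ultimately have "(q, v - Suc d) \<in> X"
      using label_closedD(2)[OF X, of "v - Suc d" q] Suc.prems v by simp
    then show ?case by simp
  qed simp
  from this[of "v - (p + 1)"] have "(q, p + 1) \<in> X" using v by (cases "v = p + 1") auto
  then show ?thesis using label_closedD[OF X, of p q] v by simp
qed

text \<open>Reflection exchanges the two alternatives of the forcing rule, as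
  \<open>n - (q - 1) = (n - q) + 1\<close>.\<close>

lemma label_closed_reflect:
  assumes "label_closed n X"
  shows "label_closed n (reflect_labels n X)"
  unfolding label_closed_def
proof (intro allI impI)
  fix p q assume a: "1 \<le> p \<and> p < q \<and> q < n \<and>
    ((p, q - 1) \<in> reflect_labels n X \<or> (q, p + 1) \<in> reflect_labels n X)"
  have "1 \<le> n - q" "n - q < n - p" "n - p < n" using a by auto
  moreover have "n - (q - 1) = (n - q) + 1" "n - (p + 1) = (n - p) - 1" using a by auto
  then have "(n - q, (n - p) - 1) \<in> X \<or> (n - p, (n - q) + 1) \<in> X"
    using a unfolding reflect_labels_def by auto
  ultimately have "(n - q, n - p) \<in> X \<and> (n - p, n - q) \<in> X"
    using assms unfolding label_closed_def by blast
  then show "(p, q) \<in> reflect_labels n X \<and> (q, p) \<in> reflect_labels n X"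
    using a unfolding reflect_labels_def labels_def by auto
qed

lemma reflect_reflect_labels:
  assumes "X \<subseteq> labels n"
  shows "reflect_labels n (reflect_labels n X) = X"
proof -
  have "(x, y) \<in> reflect_labels n (reflect_labels n X) \<longleftrightarrow> (x, y) \<in> X" if "(x, y) \<in> labels n" for x y
  proof -
    have "(n - x, n - y) \<in> labels n" "n - (n - x) = x" "n - (n - y) = y"
      using that unfolding labels_def by auto
    then show ?thesis using that unfolding reflect_labels_def by simp
  qed
  moreover have "reflect_labels n (reflect_labels n X) \<subseteq> labels n" unfolding reflect_labels_def by auto
  ultimately show ?thesis using assms by (intro equalityI subrelI) blast+
qed

section \<open>Labels under reflection\<close>

text \<open>The witness is \<open>v = q\<close> for a value above \<open>q\<close>, and
  \<open>v = a q\<close> for a value below \<open>q\<close>.\<close>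

lemma pointer_ge_iff:
  assumes a: "a \<in> pointers n" and "1 \<le> p" "p \<le> q" "q < n"
  shows "p \<le> a q \<longleftrightarrow> (\<exists>v\<in>{p..q}. (q, v) \<in> label_set n a)"
proof
  assume le: "p \<le> a q"
  show "\<exists>v\<in>{p..q}. (q, v) \<in> label_set n a"
  proof (cases "q < a q")
    case True
    then show ?thesis using assms by (intro bexI[of _ q]) (auto simp: label_set_def labels_def)
  next
    case False
    then have "a q < q" using pointers_neq[OF a, of q] assms by auto
    then show ?thesis using assms le pointers_up[OF a, of q]
      by (intro bexI[of _ "a q"]) (auto simp: label_set_def labels_def)
  qed
next
  assume "\<exists>v\<in>{p..q}. (q, v) \<in> label_set n a"
  then show "p \<le> a q" by (auto simp: label_set_def split: if_splits)
qed

text \<open>A label of the reflection expresses upper bounds on values of \<open>a\<close>. Stating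
  them through absent labels of \<open>a\<close> gives the dual description of the label
  kernel.\<close>

lemma reflect_label_iff:
  assumes a: "a \<in> pointers n" and xy: "(x, y) \<in> labels n"
  shows "(n - x, n - y) \<in> label_set n (reflect n a) \<longleftrightarrow>
    (if y \<le> x then \<not> (\<exists>v\<in>{y..x}. (x, v) \<in> label_set n a)
     else (x, y) \<notin> label_set n a \<and> \<not> (\<exists>v\<in>{x<..y}. (y, v) \<in> label_set n a))"
proof -
  have b: "1 \<le> x" "x < n" "1 \<le> y" "y < n" using xy unfolding labels_def by auto
  have "(n - x, n - y) \<in> label_set n (reflect n a) \<longleftrightarrow>
      (if y \<le> x then a x < y else a x \<le> y \<and> a y < x)"
    using b pointers_le[OF a, of x] pointers_le[OF a, of y]
    unfolding label_set_def labels_def reflect_def by auto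
  also have "\<dots> \<longleftrightarrow> (if y \<le> x then \<not> (\<exists>v\<in>{y..x}. (x, v) \<in> label_set n a)
     else (x, y) \<notin> label_set n a \<and> \<not> (\<exists>v\<in>{x<..y}. (y, v) \<in> label_set n a))"
  proof (cases "y \<le> x")
    case True
    then show ?thesis using pointer_ge_iff[OF a, of y x] b by auto
  next
    case False
    have l: "(x, y) \<in> label_set n a \<longleftrightarrow> y < a x"
      using False xy unfolding label_set_def by auto
    \<comment> \<open>This allows \<open>v = x\<close> to be left out of the range, which matters
      later: \<open>(y, x)\<close> may be contracted although \<open>(x, y)\<close> is not.\<close>
    have "(y, x) \<in> label_set n a \<Longrightarrow> (x, y) \<in> label_set n a"
      using False xy unfolding label_set_def labels_def by auto
    moreover have "{x..y} = insert x {x<..y}" using False by auto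
    moreover have "a y < x \<longleftrightarrow> \<not> (\<exists>v\<in>{x..y}. (y, v) \<in> label_set n a)"
      using pointer_ge_iff[OF a, of x y] b False by auto
    ultimately have "a x \<le> y \<and> a y < x \<longleftrightarrow>
        (x, y) \<notin> label_set n a \<and> \<not> (\<exists>v\<in>{x<..y}. (y, v) \<in> label_set n a)"
      using l by auto
    then show ?thesis using False by simp
  qed
  finally show ?thesis .
qed

text \<open>
  The heart of the argument: reflection is an anti-automorphism, so for closed \<open>X\<close> this turns
  compatibility with meets into compatibility with joins.
\<close>
lemma kernel_reflect:
  assumes X: "label_closed n X"
    and ab: "(a, b) \<in> pointer_lattice.label_kernel n X"
  shows "(reflect n a, reflect n b) \<in> pointer_lattice.label_kernel n (reflect_labels n X)"
proof -
  have a: "a \<in> pointers n" and b: "b \<in> pointers n"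
    and eq: "label_set n a - X = label_set n b - X"
    using ab unfolding pointer_lattice.label_kernel_def by auto
  have same: "j \<in> label_set n a \<longleftrightarrow> j \<in> label_set n b" if "j \<notin> X" for j using eq that by auto
  have iff: "(n - x, n - y) \<in> label_set n (reflect n a) \<longleftrightarrow>
      (n - x, n - y) \<in> label_set n (reflect n b)"
    if xy: "(x, y) \<in> labels n" "(x, y) \<notin> X" for x y
  proof (cases "y \<le> x")
    case True
    \<comment> \<open>A contracted \<open>(x, v)\<close> with \<open>y < v\<close> would force
      \<open>(x, y)\<close> into \<open>X\<close>.\<close>
    have "(x, v) \<notin> X" if "v \<in> {y..x}" for v
      using label_closed_up[OF X, of x v y] xy that unfolding labels_def by (cases "v = y") auto
    then show ?thesis unfolding reflect_label_iff[OF a xy(1)] reflect_label_iff[OF b xy(1)]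
      using True same by auto
  next
    case False
    have "(y, v) \<notin> X" if "v \<in> {x<..y}" for v
      using label_closed_up[OF X, of y v x] xy that unfolding labels_def by auto
    then show ?thesis unfolding reflect_label_iff[OF a xy(1)] reflect_label_iff[OF b xy(1)]
      using False same xy by auto
  qed
  have "label_set n (reflect n a) - reflect_labels n X = label_set n (reflect n b) - reflect_labels n X"
  proof -
    have "j \<in> label_set n (reflect n a) \<longleftrightarrow> j \<in> label_set n (reflect n b)"
      if j: "j \<in> labels n" "j \<notin> reflect_labels n X" for j
    proof -
      obtain x y where xy: "j = (x, y)" by (cases j)
      have "(n - x, n - y) \<in> labels n" "(n - x, n - y) \<notin> X" "n - (n - x) = x" "n - (n - y) = y"
        using j unfolding xy reflect_labels_def labels_def by auto
      then show ?thesis using iff[of "n - x" "n - y"] unfolding xy by simp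
    qed
    moreover have "label_set n t \<subseteq> labels n" for t unfolding label_set_def by auto
    ultimately show ?thesis by blast
  qed
  then show ?thesis unfolding pointer_lattice.label_kernel_def using a b reflect_pointers by simp
qed

lemma reflect_join:
  assumes a: "a \<in> pointers n" and b: "b \<in> pointers n"
  shows "reflect n (a \<squnion>\<^bsub>pointer_lattice n\<^esub> b) = reflect n a \<sqinter>\<^bsub>pointer_lattice n\<^esub> reflect n b"
proof -
  let ?L = "pointer_lattice n"
  let ?j = "a \<squnion>\<^bsub>?L\<^esub> b" and ?m = "reflect n a \<sqinter>\<^bsub>?L\<^esub> reflect n b"
  have j: "?j \<in> pointers n" "a \<le> ?j" "b \<le> ?j"
    using pointer_lattice.join_closed[OF a b] pointer_lattice.join_left[OF a b]
      pointer_lattice.join_right[OF a b] by auto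
  note ra = reflect_pointers[OF a] and rb = reflect_pointers[OF b]
  have m: "?m \<in> pointers n" "?m \<le> reflect n a" "?m \<le> reflect n b"
    using pointer_lattice.meet_closed[OF ra rb] pointer_lattice.meet_left[OF ra rb]
      pointer_lattice.meet_right[OF ra rb] by auto
  have "reflect n ?j \<le> ?m"
    using j ra rb reflect_pointers reflect_antimono by (intro pointer_lattice.meet_le) auto
  moreover have "?j \<le> reflect n ?m"
    using m a b reflect_pointers le_reflect_iff by (intro pointer_lattice.join_le) auto
  then have "?m \<le> reflect n ?j" using le_reflect_iff j m by blast
  ultimately show ?thesis by simp
qed

text \<open>Only joins need an argument: reflect, take the meet within the kernel of the reflected
  labels, and reflect back.\<close>

lemma kernel_congruence:
  assumes X: "label_closed n X" "X \<subseteq> labels n"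
  shows "lattice_congruence (pointer_lattice n) (pointer_lattice.label_kernel n X)"
proof -
  let ?L = "pointer_lattice n" and ?K = "pointer_lattice.label_kernel n X"
  have "(a \<squnion>\<^bsub>?L\<^esub> c, b \<squnion>\<^bsub>?L\<^esub> d) \<in> ?K" if ab: "(a, b) \<in> ?K" and cd: "(c, d) \<in> ?K" for a b c d
  proof -
    have car: "a \<in> pointers n" "b \<in> pointers n" "c \<in> pointers n" "d \<in> pointers n"
      using ab cd unfolding pointer_lattice.label_kernel_def by auto
    have jc: "a \<squnion>\<^bsub>?L\<^esub> c \<in> pointers n" "b \<squnion>\<^bsub>?L\<^esub> d \<in> pointers n"
      using car pointer_lattice.join_closed by auto
    have "(reflect n (a \<squnion>\<^bsub>?L\<^esub> c), reflect n (b \<squnion>\<^bsub>?L\<^esub> d))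
        \<in> pointer_lattice.label_kernel n (reflect_labels n X)"
      using pointer_lattice.kernel_meet[OF kernel_reflect[OF X(1) ab] kernel_reflect[OF X(1) cd]]
        reflect_join car by simp
    from kernel_reflect[OF label_closed_reflect[OF X(1)] this] show ?thesis
      using reflect_reflect jc reflect_reflect_labels[OF X(2)] by simp
  qed
  moreover have "equiv (carrier ?L) ?K" using pointer_lattice.equiv_kernel by simp
  ultimately show ?thesis
    unfolding lattice_congruence_def using pointer_lattice.kernel_meet by fast
qed

text \<open>A test for forcing: contracting \<open>j\<close> identifies the joins of
  \<open>z\<close> with \<open>join_irr j\<close> and with \<open>join_irr_lower j\<close>. A label
  that the first join must carry, while the second lacks it because it lies below \<open>w\<close>,
  has to be contracted.\<close>

lemma join_contract:
  assumes X: "X \<subseteq> labels n" and cong: "lattice_congruence (pointer_lattice n) (pointer_lattice.label_kernel n X)"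
    and j: "j \<in> X" and z: "z \<in> pointers n" and w: "w \<in> pointers n" "join_irr_lower j \<le> w" "z \<le> w"
    and i: "i \<in> labels n" "i \<notin> label_set n w"
    and up: "\<And>u. u \<in> pointers n \<Longrightarrow> join_irr j \<le> u \<Longrightarrow> z \<le> u \<Longrightarrow> i \<in> label_set n u"
  shows "i \<in> X"
proof (rule ccontr)
  assume iX: "i \<notin> X"
  let ?L = "pointer_lattice n"
  have jl: "j \<in> labels n" using X j by auto
  note ej = join_irr_pointers[OF jl] and dj = join_irr_lower_pointers[OF jl]
  have "(join_irr j, join_irr_lower j) \<in> pointer_lattice.label_kernel n X"
    unfolding pointer_lattice.label_kernel_def using ej dj label_set_join_irr_lower[OF jl] j by auto
  moreover have "(z, z) \<in> pointer_lattice.label_kernel n X"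
    unfolding pointer_lattice.label_kernel_def using z by auto
  ultimately have "(join_irr j \<squnion>\<^bsub>?L\<^esub> z, join_irr_lower j \<squnion>\<^bsub>?L\<^esub> z) \<in> pointer_lattice.label_kernel n X"
    using cong unfolding lattice_congruence_def by auto
  then have "i \<in> label_set n (join_irr j \<squnion>\<^bsub>?L\<^esub> z) \<longleftrightarrow> i \<in> label_set n (join_irr_lower j \<squnion>\<^bsub>?L\<^esub> z)"
    unfolding pointer_lattice.label_kernel_def using iX by auto
  moreover have "i \<in> label_set n (join_irr j \<squnion>\<^bsub>?L\<^esub> z)"
    using up pointer_lattice.join_closed[OF ej z] pointer_lattice.join_left[OF ej z]
      pointer_lattice.join_right[OF ej z] by auto
  moreover have "join_irr_lower j \<squnion>\<^bsub>?L\<^esub> z \<le> w"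
    using w dj z by (intro pointer_lattice.join_le) auto
  then have "label_set n (join_irr_lower j \<squnion>\<^bsub>?L\<^esub> z) \<subseteq> label_set n w"
    using label_set_le_iff pointer_lattice.join_closed[OF dj z] w by auto
  ultimately show False using i by auto
qed

lemma congruence_kernel_closed:
  assumes X: "X \<subseteq> labels n"
    and cong: "lattice_congruence (pointer_lattice n) (pointer_lattice.label_kernel n X)"
  shows "label_closed n X"
  unfolding label_closed_def
proof (intro allI impI)
  fix p q assume a: "1 \<le> p \<and> p < q \<and> q < n \<and> ((p, q - 1) \<in> X \<or> (q, p + 1) \<in> X)"
  then have pq: "1 \<le> p" "p < q" "q < n" by auto
  have pql: "(p, q) \<in> labels n" "(q, p) \<in> labels n" using pq unfolding labels_def by auto
  have both: "(p, q) \<in> label_set n u \<and> (q, p) \<in> label_set n u"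
    if u: "u \<in> pointers n" "q \<le> u p" "p \<le> u q" for u
  proof -
    \<comment> \<open>The value \<open>q\<close> at \<open>p\<close> would require
      \<open>u q < p\<close>, so the bound \<open>q \<le> u p\<close> is strict, as both labels of
      \<open>[p, q]\<close> ask.\<close>
    have "u p \<noteq> q" using pointers_down[OF u(1), of p] u pq by auto
    then show ?thesis using u pq unfolding label_set_def labels_def by auto
  qed
  have neither: "(p, q) \<notin> label_set n w \<and> (q, p) \<notin> label_set n w" if "w p \<le> q" for w
    using that pq unfolding label_set_def by auto
  have "i \<in> X" if i: "i = (p, q) \<or> i = (q, p)" for i
    using a
  proof (elim conjE disjE)
    assume j: "(p, q - 1) \<in> X"
    \<comment> \<open>The label supplies \<open>q \<le> u p\<close> and \<open>z\<close> supplies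
      \<open>p \<le> u q\<close>. The bound \<open>w\<close> superimposes \<open>z\<close> on the
      lower cover, which vanishes for \<open>p = q - 1\<close>.\<close>
    define z :: "nat \<Rightarrow> nat" where "z = (\<lambda>_. 0)(q := Suc q)"
    define w :: "nat \<Rightarrow> nat" where "w = (\<lambda>_. 0)(p := if p < q - 1 then q - 1 else 0, q := Suc q)"
    show "i \<in> X"
    proof (rule join_contract[OF X cong j])
      show "z \<in> pointers n" unfolding z_def using pq by (auto intro!: pointersI split: if_splits)
      show "w \<in> pointers n" unfolding w_def using pq by (auto intro!: pointersI split: if_splits)
      show "join_irr_lower (p, q - 1) \<le> w" "z \<le> w"
        unfolding w_def z_def join_irr_lower_def using pq by (auto simp: le_fun_def)
      show "i \<in> labels n" using i pql by auto
      show "i \<notin> label_set n w" using i neither[of w] pq unfolding w_def by auto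
      fix u assume u: "u \<in> pointers n" "join_irr (p, q - 1) \<le> u" "z \<le> u"
      have "q \<le> u p" using le_funD[OF u(2), of p] pq unfolding join_irr_def by (simp split: if_splits)
      moreover have "p \<le> u q" using le_funD[OF u(3), of q] pq unfolding z_def by simp
      ultimately show "i \<in> label_set n u" using both u(1) i by auto
    qed
  next
    assume j: "(q, p + 1) \<in> X"
    \<comment> \<open>Now the label supplies \<open>p \<le> u q\<close> and \<open>z\<close>
      supplies \<open>q \<le> u p\<close>. In \<open>w\<close> the value at \<open>p\<close> stays
      at \<open>q\<close>, one short of what the labels of \<open>[p, q]\<close> need.\<close>
    define z :: "nat \<Rightarrow> nat" where "z = (\<lambda>_. 0)(p := q)"
    define w :: "nat \<Rightarrow> nat" where "w = (\<lambda>_. 0)(p := q, p + 1 := if p + 1 < q then Suc q else 0)"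
    show "i \<in> X"
    proof (rule join_contract[OF X cong j])
      show "z \<in> pointers n" unfolding z_def using pq by (auto intro!: pointersI split: if_splits)
      show "w \<in> pointers n" unfolding w_def using pq by (auto intro!: pointersI split: if_splits)
      show "join_irr_lower (q, p + 1) \<le> w" "z \<le> w"
        unfolding w_def z_def join_irr_lower_def using pq by (auto simp: le_fun_def)
      show "i \<in> labels n" using i pql by auto
      show "i \<notin> label_set n w" using i neither[of w] pq unfolding w_def by auto
      fix u assume u: "u \<in> pointers n" "join_irr (q, p + 1) \<le> u" "z \<le> u"
      have "p \<le> u q" using le_funD[OF u(2), of q] pq unfolding join_irr_def by (simp split: if_splits)
      moreover have "q \<le> u p" using le_funD[OF u(3), of p] pq unfolding z_def by simp
      ultimately show "i \<in> label_set n u" using both u(1) i by auto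
    qed
  qed
  then show "(p, q) \<in> X \<and> (q, p) \<in> X" by blast
qed

lemma card_pointer_congruences:
  "card {r. lattice_congruence (pointer_lattice n) r} = card {X. X \<subseteq> labels n \<and> label_closed n X}"
  unfolding pointer_lattice.card_congruences
  by (rule arg_cong[where f = card]) (use kernel_congruence congruence_kernel_closed in blast)

section \<open>Small tableaux as pointers\<close>

text \<open>One of \<open>max k (t k)\<close> and \<open>min k (t k)\<close> equals
  \<open>k\<close>, so one of the two cells placed for \<open>k\<close> is the border cell
  \<open>(Suc k, k)\<close> and the other is the arrow recorded by \<open>t k\<close>.\<close>

definition tableau :: "nat \<Rightarrow> (nat \<Rightarrow> nat) \<Rightarrow> cell set" where
  "tableau n t = insert (1, n)
     ((\<lambda>k. (Suc k, max k (t k))) ` {1..<n} \<union> (\<lambda>k. (Suc (min k (t k)), k)) ` {1..<n})"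

lemma mem_tableau:
  "(i, j) \<in> tableau n t \<longleftrightarrow> (i, j) = (1, n) \<or> (\<exists>k\<in>{1..<n}. i = Suc k \<and> j = max k (t k)) \<or>
     (j \<in> {1..<n} \<and> i = Suc (min j (t j)))"
  unfolding tableau_def by auto

text \<open>Row \<open>Suc k\<close> also contains the up-arrows of columns \<open>j\<close> with
  \<open>t j = k < j\<close>. For these \<open>j < t k\<close>, so they lie to the right of the
  left-arrow.\<close>

lemma left_iff:
  assumes t: "t \<in> pointers n" and k: "1 \<le> k" "k < n"
  shows "(\<exists>d\<in>tableau n t. strictly_left d (Suc k, j)) \<longleftrightarrow> j < max k (t k)"
proof
  assume "\<exists>d\<in>tableau n t. strictly_left d (Suc k, j)"
  then obtain j' where j': "(Suc k, j') \<in> tableau n t" "j < j'"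
    unfolding strictly_left_def by auto
  have "j' \<le> max k (t k)"
  proof (cases "j' \<in> {1..<n} \<and> k = min j' (t j')")
    case True
    then have "t j' = k \<and> k < j' \<or> j' = k" by (auto simp: min_def split: if_splits)
    then show ?thesis using pointers_up[OF t, of j'] k True by auto
  next
    case False
    then show ?thesis using j'(1) k unfolding mem_tableau by auto
  qed
  then show "j < max k (t k)" using j' by simp
next
  assume "j < max k (t k)"
  then show "\<exists>d\<in>tableau n t. strictly_left d (Suc k, j)"
    using k unfolding strictly_left_def by (intro bexI[of _ "(Suc k, max k (t k))"]) (auto simp: mem_tableau)
qed

text \<open>Column \<open>k\<close> also contains the left-arrows of rows \<open>Suc l\<close> with
  \<open>t l = k > l\<close>. For these \<open>t k < l\<close>, so they lie below the
  up-arrow.\<close>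

lemma above_iff:
  assumes t: "t \<in> pointers n" and k: "1 \<le> k" "k < n"
  shows "(\<exists>d\<in>tableau n t. strictly_above d (i, k)) \<longleftrightarrow> Suc (min k (t k)) < i"
proof
  assume "\<exists>d\<in>tableau n t. strictly_above d (i, k)"
  then obtain i' where i': "(i', k) \<in> tableau n t" "i' < i"
    unfolding strictly_above_def by auto
  have "Suc (min k (t k)) \<le> i'"
  proof (cases "\<exists>l\<in>{1..<n}. i' = Suc l \<and> k = max l (t l)")
    case True
    then obtain l where l: "1 \<le> l" "l < n" "i' = Suc l" "k = max l (t l)" by auto
    then have "t l = k \<and> l < k \<or> l = k" by (auto simp: max_def split: if_splits)
    then show ?thesis using pointers_down[OF t, of l] l k by auto
  next
    case False
    then show ?thesis using i'(1) k unfolding mem_tableau by auto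
  qed
  then show "Suc (min k (t k)) < i" using i' by simp
next
  assume "Suc (min k (t k)) < i"
  then show "\<exists>d\<in>tableau n t. strictly_above d (i, k)"
    using k unfolding strictly_above_def by (intro bexI[of _ "(Suc (min k (t k)), k)"]) (auto simp: mem_tableau)
qed

lemma tableau_subset_board:
  assumes t: "t \<in> pointers n" and n: "1 \<le> n"
  shows "tableau n t \<subseteq> board n"
proof -
  have "max k (t k) \<le> n" if "k < n" for k using pointers_le[OF t, of k] that by auto
  then show ?thesis using n unfolding tableau_def board_def by force
qed

lemma left_row_1: "\<lbrakk>t \<in> pointers n; 1 \<le> n\<rbrakk> \<Longrightarrow>
    (\<exists>d\<in>tableau n t. strictly_left d (1, j)) \<longleftrightarrow> j < n"
  using tableau_subset_board[of t n] unfolding strictly_left_def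
  by (auto simp: board_def mem_tableau intro!: bexI[of _ "(1, n)"])

lemma above_col_n: "\<lbrakk>t \<in> pointers n; 1 \<le> n\<rbrakk> \<Longrightarrow>
    (\<exists>d\<in>tableau n t. strictly_above d (i, n)) \<longleftrightarrow> 1 < i"
  using tableau_subset_board[of t n] unfolding strictly_above_def
  by (auto simp: board_def mem_tableau intro!: bexI[of _ "(1, n)"])

lemma left_arrow_tableau:
  assumes t: "t \<in> pointers n" and n: "1 \<le> n"
  shows "left_arrow n (tableau n t) c \<longleftrightarrow> (\<exists>k\<in>{1..<n}. c = (Suc k, max k (t k)))"
proof
  assume c: "left_arrow n (tableau n t) c"
  obtain i j where ij: "c = (i, j)" by (cases c)
  have T: "(i, j) \<in> tableau n t" "(i, j) \<noteq> (1, n)"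
    and nl: "\<not> (\<exists>d\<in>tableau n t. strictly_left d (i, j))"
    using c ij unfolding left_arrow_def root_cell_def by auto
  have b: "(i, j) \<in> board n" using T tableau_subset_board[OF t n] by auto
  have "i \<noteq> 1" using left_row_1[OF t n, of j] nl T b unfolding board_def by auto
  then obtain k where k: "i = Suc k" "1 \<le> k" "k < n" using b unfolding board_def by (cases i) auto
  then have "max k (t k) \<le> j" using left_iff[OF t k(2,3)] nl by auto
  moreover have "j \<le> max k (t k)"
  proof (rule ccontr)
    assume "\<not> j \<le> max k (t k)"
    then have "j \<in> {1..<n}" "k = min j (t j)" using T k unfolding mem_tableau by auto
    then have "t j = k \<and> k < j \<or> j = k" by (auto simp: min_def split: if_splits)
    then show False using pointers_up[OF t, of j] k \<open>j \<in> {1..<n}\<close> \<open>\<not> j \<le> max k (t k)\<close> by auto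
  qed
  ultimately show "\<exists>k\<in>{1..<n}. c = (Suc k, max k (t k))" using k ij by auto
next
  assume "\<exists>k\<in>{1..<n}. c = (Suc k, max k (t k))"
  then obtain k where k: "1 \<le> k" "k < n" "c = (Suc k, max k (t k))" by auto
  then show "left_arrow n (tableau n t) c"
    using left_iff[OF t k(1,2)] unfolding left_arrow_def root_cell_def
    by (auto simp: mem_tableau)
qed

lemma up_arrow_tableau:
  assumes t: "t \<in> pointers n" and n: "1 \<le> n"
  shows "up_arrow n (tableau n t) c \<longleftrightarrow> (\<exists>k\<in>{1..<n}. c = (Suc (min k (t k)), k))"
proof
  assume c: "up_arrow n (tableau n t) c"
  obtain i j where ij: "c = (i, j)" by (cases c)
  have T: "(i, j) \<in> tableau n t" "(i, j) \<noteq> (1, n)"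
    and nl: "\<not> (\<exists>d\<in>tableau n t. strictly_above d (i, j))"
    using c ij unfolding up_arrow_def root_cell_def by auto
  have b: "(i, j) \<in> board n" using T tableau_subset_board[OF t n] by auto
  have "j \<noteq> n" using above_col_n[OF t n, of i] nl T b unfolding board_def by auto
  then have k: "1 \<le> j" "j < n" using b unfolding board_def by auto
  then have "i \<le> Suc (min j (t j))" using above_iff[OF t k] nl by auto
  moreover have "Suc (min j (t j)) \<le> i"
  proof (rule ccontr)
    assume a: "\<not> Suc (min j (t j)) \<le> i"
    then obtain l where l: "1 \<le> l" "l < n" "i = Suc l" "j = max l (t l)"
      using T k unfolding mem_tableau by auto
    then have "t l = j \<and> l < j \<or> l = j" by (auto simp: max_def split: if_splits)
    then show False using pointers_down[OF t, of l] l k a by auto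
  qed
  ultimately show "\<exists>k\<in>{1..<n}. c = (Suc (min k (t k)), k)" using k ij by auto
next
  assume "\<exists>k\<in>{1..<n}. c = (Suc (min k (t k)), k)"
  then obtain k where k: "1 \<le> k" "k < n" "c = (Suc (min k (t k)), k)" by auto
  then show "up_arrow n (tableau n t) c"
    using above_iff[OF t k(1,2)] unfolding up_arrow_def root_cell_def
    by (auto simp: mem_tableau)
qed

lemma tableau_small:
  assumes t: "t \<in> pointers n" and n: "1 \<le> n"
  shows "small n (tableau n t)"
proof -
  have "c \<in> tableau n t \<Longrightarrow> c = (1, n) \<or> left_arrow n (tableau n t) c \<or> up_arrow n (tableau n t) c" for c
    by (cases c) (auto simp: left_arrow_tableau[OF t n] up_arrow_tableau[OF t n] mem_tableau)
  moreover have "\<not> left_arrow n (tableau n t) (1, n)" "\<not> up_arrow n (tableau n t) (1, n)"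
    unfolding left_arrow_def up_arrow_def root_cell_def by auto
  moreover have "(1, n) \<in> tableau n t" unfolding tableau_def by simp
  ultimately show ?thesis unfolding small_def is_dot_def root_cell_def by blast
qed

lemma tableau_fb:
  assumes t: "t \<in> pointers n" and n: "1 \<le> n"
  shows "fb_tableau n (tableau n t)"
proof -
  have bd: "(Suc k, k) \<in> tableau n t" if "1 \<le> k" "k < n" for k
    using that unfolding mem_tableau by (cases "t k < k") auto
  have "border n \<subseteq> tableau n t"
  proof
    fix c assume "c \<in> border n"
    then obtain i where "c = (i, i - 1)" "2 \<le> i" "i \<le> n" unfolding border_def by auto
    then show "c \<in> tableau n t" using bd[of "i - 1"] by auto
  qed
  moreover have "\<exists>d\<in>tableau n t. strictly_left d c \<or> strictly_above d c"
    if c: "c \<in> tableau n t" "c \<noteq> (1, n)" for c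
  proof -
    obtain i j where ij: "c = (i, j)" by (cases c)
    have "(i, j) \<in> tableau n t" "(i, j) \<noteq> (1, n)" using c ij by auto
    then consider k where "1 \<le> k" "k < n" "i = Suc k" "j = max k (t k)"
      | "1 \<le> j" "j < n" "i = Suc (min j (t j))"
      unfolding mem_tableau by auto
    then show ?thesis
    proof cases
      case (1 k)
      have "j \<le> n" using 1 pointers_le[OF t, of k] by auto
      have "\<exists>d\<in>tableau n t. strictly_above d (i, j)"
      proof (cases "j = n")
        case True
        then show ?thesis using above_col_n[OF t n, of i] 1 by auto
      next
        case False
        then have "j < n" using \<open>j \<le> n\<close> by simp
        \<comment> \<open>If \<open>k < t k\<close>, then \<open>j = t k\<close> and
          \<open>t (t k) < k\<close>. If \<open>t k < k\<close>, then \<open>j = k\<close> and the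
          up-arrow of column \<open>k\<close> itself lies above.\<close>
        moreover have "min j (t j) < k"
          using pointers_neq[OF t, of k] pointers_down[OF t, of k] 1 \<open>j < n\<close>
          by (cases "k < t k") auto
        ultimately show ?thesis using above_iff[OF t, of j i] 1 by auto
      qed
      then show ?thesis using ij by blast
    next
      case 2
      have "\<exists>d\<in>tableau n t. strictly_left d (i, j)"
      proof (cases "min j (t j) = 0")
        case True
        then show ?thesis using left_row_1[OF t n, of j] 2 by auto
      next
        case False
        let ?k = "min j (t j)"
        have "j < max ?k (t ?k)"
          using pointers_neq[OF t, of j] pointers_up[OF t, of j] 2 False
          by (cases "t j < j") auto
        then show ?thesis using left_iff[OF t, of ?k j] 2 False by auto
      qed
      then show ?thesis using ij by blast
    qed
  qed
  moreover have "(1, n) \<in> tableau n t" unfolding tableau_def by simp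
  ultimately show ?thesis
    unfolding fb_tableau_def root_cell_def using tableau_subset_board[OF t n] by blast
qed

lemma Row_tableau:
  assumes t: "t \<in> pointers n" and n: "1 \<le> n"
  shows "Row n (tableau n t) = {(i, j) \<in> board n. i = 1 \<or> j \<le> max (i - 1) (t (i - 1))}"
proof -
  have "(i, j) \<in> Row n (tableau n t) \<longleftrightarrow> i = 1 \<or> j \<le> max (i - 1) (t (i - 1))"
    if b: "(i, j) \<in> board n" for i j
  proof (cases "i = 1")
    case True
    then show ?thesis using b
      unfolding Row_def root_cell_def strictly_left_def board_def by (force intro!: exI[of _ "(1, n)"])
  next
    case False
    then obtain k where k: "i = Suc k" "1 \<le> k" "k < n" using b unfolding board_def by (cases i) auto
    have la: "left_arrow n (tableau n t) (Suc k, max k (t k))"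
      using k unfolding left_arrow_tableau[OF t n] by auto
    show ?thesis
    proof
      assume "(i, j) \<in> Row n (tableau n t)"
      then show "i = 1 \<or> j \<le> max (i - 1) (t (i - 1))"
        unfolding Row_def left_arrow_tableau[OF t n] root_cell_def strictly_left_def by auto
    next
      assume "i = 1 \<or> j \<le> max (i - 1) (t (i - 1))"
      then have "(Suc k, max k (t k)) = (i, j) \<or> strictly_left (Suc k, max k (t k)) (i, j)"
        using k unfolding strictly_left_def by auto
      then show "(i, j) \<in> Row n (tableau n t)" using la b unfolding Row_def by blast
    qed
  qed
  moreover have "Row n (tableau n t) \<subseteq> board n" unfolding Row_def by auto
  ultimately show ?thesis by blast
qed

lemma Col_tableau:
  assumes t: "t \<in> pointers n" and n: "1 \<le> n"
  shows "Col n (tableau n t) = {(i, j) \<in> board n. j = n \<or> min j (t j) < i}"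
proof -
  have "(i, j) \<in> Col n (tableau n t) \<longleftrightarrow> j = n \<or> min j (t j) < i"
    if b: "(i, j) \<in> board n" for i j
  proof (cases "j = n")
    case True
    then show ?thesis using b
      unfolding Col_def root_cell_def strictly_above_def board_def by (force intro!: exI[of _ "(1, n)"])
  next
    case False
    then have j: "1 \<le> j" "j < n" using b unfolding board_def by auto
    then have ua: "up_arrow n (tableau n t) (Suc (min j (t j)), j)"
      unfolding up_arrow_tableau[OF t n] by auto
    show ?thesis
    proof
      assume "(i, j) \<in> Col n (tableau n t)"
      then show "j = n \<or> min j (t j) < i"
        unfolding Col_def up_arrow_tableau[OF t n] root_cell_def strictly_above_def by auto
    next
      assume "j = n \<or> min j (t j) < i"
      then have "(Suc (min j (t j)), j) = (i, j) \<or> strictly_above (Suc (min j (t j)), j) (i, j)"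
        using False unfolding strictly_above_def by auto
      then show "(i, j) \<in> Col n (tableau n t)" using ua b unfolding Col_def by blast
    qed
  qed
  moreover have "Col n (tableau n t) \<subseteq> board n" unfolding Col_def by auto
  ultimately show ?thesis by blast
qed

text \<open>Columns compare \<open>min k\<close> and rows compare \<open>max k\<close> of the
  values; as minimum and maximum add up to \<open>k\<close> plus the value, together they compare
  the values. Dots impose nothing: the only one is the root, which is not free.\<close>

lemma fb_le_tableau:
  assumes s: "s \<in> pointers n" and t: "t \<in> pointers n" and n: "1 \<le> n"
  shows "fb_le n (tableau n s) (tableau n t) \<longleftrightarrow> t \<le> s"
proof
  assume le: "fb_le n (tableau n s) (tableau n t)"
  show "t \<le> s"
  proof (rule le_funI)
    fix k
    show "t k \<le> s k"
    proof (cases "k \<in> {1..<n}")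
      case False
      then show ?thesis using pointers_outside[OF t] by simp
    next
      case True
      then have k: "1 \<le> k" "k < n" by auto
      have "(Suc (min k (s k)), k) \<in> Col n (tableau n s)"
        unfolding Col_tableau[OF s n] board_def using k by auto
      then have "(Suc (min k (s k)), k) \<in> Col n (tableau n t)" using le unfolding fb_le_def by auto
      then have 1: "min k (t k) \<le> min k (s k)" unfolding Col_tableau[OF t n] using k by auto
      have "(Suc k, max k (t k)) \<in> Row n (tableau n t)"
        unfolding Row_tableau[OF t n] board_def using k pointers_le[OF t, of k] by auto
      then have "(Suc k, max k (t k)) \<in> Row n (tableau n s)" using le unfolding fb_le_def by auto
      then have 2: "max k (t k) \<le> max k (s k)" unfolding Row_tableau[OF s n] using k by auto
      show ?thesis using 1 2 by linarith
    qed
  qed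
next
  assume le: "t \<le> s"
  have l: "t k \<le> s k" for k using le by (simp add: le_fun_def)
  have "Col n (tableau n s) \<subseteq> Col n (tableau n t)"
    unfolding Col_tableau[OF s n] Col_tableau[OF t n] by (auto simp: min_less_iff_disj intro: le_less_trans[OF l])
  moreover have "Row n (tableau n t) \<subseteq> Row n (tableau n s)"
    unfolding Row_tableau[OF s n] Row_tableau[OF t n] by (auto simp: le_max_iff_disj intro: order_trans[OF _ l])
  moreover have "\<not> (free_cell n (tableau n s) c \<and> is_dot n (tableau n s) c)" for c
  proof
    assume a: "free_cell n (tableau n s) c \<and> is_dot n (tableau n s) c"
    then have "c = (1, n)" using tableau_small[OF s n] unfolding small_def root_cell_def by auto
    then obtain d where "d \<in> tableau n s" "fst d < 1"
      using a unfolding free_cell_def up_arrow_def strictly_above_def by auto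
    then show False using tableau_subset_board[OF s n] unfolding board_def by auto
  qed
  ultimately show "fb_le n (tableau n s) (tableau n t)" unfolding fb_le_def by blast
qed

section \<open>Reading the pointer off a small tableau\<close>

text \<open>A cell that is not a dot lacks a nonempty cell on one of the two sides, and the defining
  condition of a tableau provides one on the other.\<close>

lemma small_cases:
  assumes T: "fb_tableau n T" "small n T" and c: "c \<in> T" "c \<noteq> (1, n)"
  shows "(\<exists>d\<in>T. strictly_left d c) \<longleftrightarrow> \<not> (\<exists>d\<in>T. strictly_above d c)"
proof -
  have "\<not> is_dot n T c" using T(2) c unfolding small_def root_cell_def by auto
  then show ?thesis
    using T(1) c unfolding is_dot_def left_arrow_def up_arrow_def fb_tableau_def root_cell_def by blast
qed

text \<open>\<open>l k\<close> and \<open>u k\<close> locate the leftmost cell of row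
  \<open>Suc k\<close> and the topmost cell of column \<open>k\<close>. Exactly one of these two is
  the border cell \<open>(Suc k, k)\<close>, so the single number \<open>t k\<close> records
  both.\<close>

lemma small_eq_tableau:
  assumes T: "fb_tableau n T" "small n T" and n: "1 \<le> n"
  shows "\<exists>t\<in>pointers n. T = tableau n t"
proof -
  have sub: "T \<subseteq> board n" and root: "(1, n) \<in> T" and bd: "border n \<subseteq> T"
    using T(1) unfolding fb_tableau_def root_cell_def by auto
  have fin: "finite T"
    by (rule finite_subset[OF sub], rule finite_subset[of _ "{0..n} \<times> {0..n}"]) (auto simp: board_def)
  have bk: "(Suc k, k) \<in> T" if "1 \<le> k" "k < n" for k
    using bd that unfolding border_def by force
  note cases = small_cases[OF T]
  define l where "l k = Max {j. (Suc k, j) \<in> T}" for k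
  define u where "u k = Min {i. (i, k) \<in> T}" for k
  have finr: "finite {j. (i, j) \<in> T}" for i
    by (rule finite_subset[OF _ finite_imageI[OF fin, of snd]]) force
  have finc: "finite {i. (i, j) \<in> T}" for j
    by (rule finite_subset[OF _ finite_imageI[OF fin, of fst]]) force
  have l: "(Suc k, l k) \<in> T" "k \<le> l k" "l k \<le> n" "\<And>j. (Suc k, j) \<in> T \<Longrightarrow> j \<le> l k"
    if k: "1 \<le> k" "k < n" for k
  proof -
    show lT: "(Suc k, l k) \<in> T" using Max_in[OF finr[of "Suc k"]] bk[OF k] unfolding l_def by auto
    show le: "j \<le> l k" if "(Suc k, j) \<in> T" for j using Max_ge[OF finr[of "Suc k"]] that unfolding l_def by auto
    show "k \<le> l k" using le bk[OF k] by simp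
    show "l k \<le> n" using lT sub unfolding board_def by auto
  qed
  have u: "(u k, k) \<in> T" "u k \<le> Suc k" "1 \<le> u k" "\<And>i. (i, k) \<in> T \<Longrightarrow> u k \<le> i"
    if k: "1 \<le> k" "k < n" for k
  proof -
    show uT: "(u k, k) \<in> T" using Min_in[OF finc[of k]] bk[OF k] unfolding u_def by auto
    show le: "u k \<le> i" if "(i, k) \<in> T" for i using Min_le[OF finc[of k]] that unfolding u_def by auto
    show "u k \<le> Suc k" using le bk[OF k] by simp
    show "1 \<le> u k" using uT sub unfolding board_def by auto
  qed
  have left: "(\<exists>d\<in>T. strictly_left d (Suc k, j)) \<longleftrightarrow> j < l k" if k: "1 \<le> k" "k < n" for k j
  proof
    assume "\<exists>d\<in>T. strictly_left d (Suc k, j)"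
    then obtain j' where "(Suc k, j') \<in> T" "j < j'" unfolding strictly_left_def by auto
    then show "j < l k" using l(4)[OF k] by fastforce
  next
    assume "j < l k"
    then show "\<exists>d\<in>T. strictly_left d (Suc k, j)"
      using l(1)[OF k] unfolding strictly_left_def by (intro bexI[of _ "(Suc k, l k)"]) auto
  qed
  have above: "(\<exists>d\<in>T. strictly_above d (i, k)) \<longleftrightarrow> u k < i" if k: "1 \<le> k" "k < n" for k i
  proof
    assume "\<exists>d\<in>T. strictly_above d (i, k)"
    then obtain i' where "(i', k) \<in> T" "i' < i" unfolding strictly_above_def by auto
    then show "u k < i" using u(4)[OF k] by fastforce
  next
    assume "u k < i"
    then show "\<exists>d\<in>T. strictly_above d (i, k)"
      using u(1)[OF k] unfolding strictly_above_def by (intro bexI[of _ "(u k, k)"]) auto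
  qed
  have diag: "k < l k \<longleftrightarrow> u k = Suc k" if k: "1 \<le> k" "k < n" for k
    using cases[OF bk[OF k]] left[OF k] above[OF k] u(2)[OF k] k by auto
  define t where "t k = (if k \<in> {1..<n} then if k < l k then l k else u k - 1 else 0)" for k
  have tk: "t k = (if k < l k then l k else u k - 1)" if "1 \<le> k" "k < n" for k
    using that unfolding t_def by simp
  have mx: "max k (t k) = l k" and mn: "Suc (min k (t k)) = u k" if k: "1 \<le> k" "k < n" for k
    using tk[OF k] diag[OF k] u(2,3)[OF k] l(2)[OF k] by (auto split: if_splits)
  have tp: "t \<in> pointers n"
  proof (rule pointersI)
    show "t k = 0" if "k \<notin> {1..<n}" for k using that unfolding t_def by (rule if_not_P)
  next
    fix k assume k: "1 \<le> k" "k < n"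
    show "t k \<le> n \<and> t k \<noteq> k"
      using tk[OF k] diag[OF k] u(2,3)[OF k] l(2,3)[OF k] k by (auto split: if_splits)
    {
      assume a: "k < t k" "t k < n"
      have eq: "t k = l k" using mx[OF k] a by simp
      have b: "1 \<le> t k" using a by simp
      \<comment> \<open>The leftmost cell of a row has nothing to its left, so something stands
        above it.\<close>
      have "\<not> (\<exists>d\<in>T. strictly_left d (Suc k, t k))" using left[OF k] eq by simp
      moreover have "(Suc k, t k) \<in> T" "(Suc k, t k) \<noteq> (1, n)" using l(1)[OF k] eq k by auto
      ultimately have "u (t k) < Suc k" using cases above[OF b a(2)] by blast
      then show "t (t k) < k" using mn[OF b a(2)] a by auto
    }
    {
      assume a: "0 < t k" "t k < k"
      have eq: "Suc (t k) = u k" using mn[OF k] a by simp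
      have b: "1 \<le> t k" "t k < n" using a k by auto
      have "\<not> (\<exists>d\<in>T. strictly_above d (Suc (t k), k))" using above[OF k] eq by simp
      moreover have "(Suc (t k), k) \<in> T" "(Suc (t k), k) \<noteq> (1, n)" using u(1)[OF k] eq k by auto
      ultimately have "k < l (t k)" using cases left[OF b] by blast
      then show "k < t (t k)" using mx[OF b] a by auto
    }
  qed
  moreover have "T = tableau n t"
  proof
    show "tableau n t \<subseteq> T"
      unfolding tableau_def using root l(1) u(1) mx mn by auto
    show "T \<subseteq> tableau n t"
    proof
      fix c assume c: "c \<in> T"
      obtain i j where ij: "c = (i, j)" by (cases c)
      have b: "(i, j) \<in> board n" using c ij sub by auto
      show "c \<in> tableau n t"
      proof (cases "c = (1, n)")
        case True
        then show ?thesis unfolding tableau_def by simp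
      next
        case False
        show ?thesis
        \<comment> \<open>With a cell to its left, \<open>c\<close> has none above and tops its
          column; otherwise it starts its row.\<close>
        proof (cases "\<exists>d\<in>T. strictly_left d c")
          case True
          then have na: "\<not> (\<exists>d\<in>T. strictly_above d c)" using cases[OF c False] by blast
          from True have "j < n" using ij sub unfolding strictly_left_def board_def by force
          then have j: "1 \<le> j" "j < n" using b unfolding board_def by auto
          have "i = u j" using na above[OF j, of i] u(4)[OF j, of i] c ij by auto
          then show ?thesis unfolding ij mem_tableau using mn[OF j] j by auto
        next
          case nl: False
          then have "\<exists>d\<in>T. strictly_above d c" using cases[OF c False] by blast
          then have "1 < i" using ij sub unfolding strictly_above_def board_def by force
          then obtain k where k: "i = Suc k" "1 \<le> k" "k < n" using b unfolding board_def by (cases i) auto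
          have "j = l k" using nl left[OF k(2,3), of j] l(4)[OF k(2,3), of j] c ij k by auto
          then show ?thesis unfolding ij mem_tableau using mx[OF k(2,3)] k by auto
        qed
      qed
    qed
  qed
  ultimately show ?thesis by blast
qed

text \<open>The map \<open>tableau n\<close> reverses the order, hence the detour through
  \<open>inv_gorder\<close>, which has the same congruences.\<close>

lemma card_sTam_congruences:
  assumes n: "1 \<le> n"
  shows "card {r. lattice_congruence (sTam n) r} = card {r. lattice_congruence (pointer_lattice n) r}"
proof -
  have "card {r. lattice_congruence (inv_gorder (sTam n)) r}
      = card {r. lattice_congruence (pointer_lattice n) r}"
  proof (rule card_congruences_iso[OF lattice_pointers])
    show "tableau n a \<sqsubseteq>\<^bsub>inv_gorder (sTam n)\<^esub> tableau n b \<longleftrightarrow> a \<sqsubseteq>\<^bsub>pointer_lattice n\<^esub> b"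
      if "a \<in> carrier (pointer_lattice n)" "b \<in> carrier (pointer_lattice n)" for a b
      using that fb_le_tableau[OF _ _ n] by (simp add: sTam_def)
    show "bij_betw (tableau n) (carrier (pointer_lattice n)) (carrier (inv_gorder (sTam n)))"
      unfolding bij_betw_def
    proof
      show "inj_on (tableau n) (carrier (pointer_lattice n))"
      proof (rule inj_onI)
        fix s t assume st: "s \<in> carrier (pointer_lattice n)" "t \<in> carrier (pointer_lattice n)"
          "tableau n s = tableau n t"
        then have "s \<le> t" "t \<le> s"
          using fb_le_tableau[of s n t, OF _ _ n] fb_le_tableau[of t n s, OF _ _ n]
            fb_le_tableau[of s n s, OF _ _ n] by auto
        then show "s = t" by simp
      qed
      have "tableau n ` pointers n = {T. fb_tableau n T \<and> small n T}"
        using tableau_fb[OF _ n] tableau_small[OF _ n] small_eq_tableau[OF _ _ n] by blast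
      then show "tableau n ` carrier (pointer_lattice n) = carrier (inv_gorder (sTam n))"
        by (simp add: sTam_def)
    qed
  qed
  then show ?thesis by simp
qed

section \<open>Words cut at full letters\<close>

definition word_sum :: "('s list \<Rightarrow> nat) \<Rightarrow> 's set \<Rightarrow> nat \<Rightarrow> nat" where
  "word_sum f S n = (\<Sum>w | set w \<subseteq> S \<and> length w = n. f w)"

definition word_gf :: "('s list \<Rightarrow> nat) \<Rightarrow> 's set \<Rightarrow> real fps" where
  "word_gf f S = Abs_fps (\<lambda>n. of_nat (word_sum f S n))"

text \<open>A word containing \<open>c\<close> is cut at its first \<open>c\<close>: the prefix is
  over \<open>S\<close>, the suffix is arbitrary, and the weight factors.\<close>

lemma word_sum_insert:
  assumes S: "finite S" "c \<notin> S" and mult: "\<And>u v. f (u @ c # v) = f u * f v"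
  shows "word_sum f (insert c S) n =
    word_sum f S n + (\<Sum>i<n. word_sum f S i * word_sum f (insert c S) (n - 1 - i))"
proof -
  define A where "A k = {w. set w \<subseteq> S \<and> length w = k}" for k
  define B where "B k = {w. set w \<subseteq> insert c S \<and> length w = k}" for k
  have fin: "finite (A k)" "finite (B k)" for k
    unfolding A_def B_def using S by (auto intro: finite_lists_length_eq)
  define D where "D i = (\<lambda>(u, v). u @ c # v) ` (A i \<times> B (n - 1 - i))" for i
  have Bn: "B n = A n \<union> (\<Union>i<n. D i)"
  proof
    show "B n \<subseteq> A n \<union> (\<Union>i<n. D i)"
    proof
      fix w assume w: "w \<in> B n"
      show "w \<in> A n \<union> (\<Union>i<n. D i)"
      proof (cases "c \<in> set w")
        case True
        then obtain u v where uv: "w = u @ c # v" "c \<notin> set u"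
          by (meson split_list_first)
        then have "u \<in> A (length u)" "v \<in> B (n - 1 - length u)" "length u < n"
          using w unfolding A_def B_def by auto
        then show ?thesis using uv unfolding D_def by auto
      next
        case False
        then show ?thesis using w unfolding A_def B_def by auto
      qed
    qed
    show "A n \<union> (\<Union>i<n. D i) \<subseteq> B n"
      unfolding A_def B_def D_def by auto
  qed
  have disj: "A n \<inter> (\<Union>i<n. D i) = {}" using S unfolding A_def D_def by auto
  \<comment> \<open>The position of the first \<open>c\<close> identifies \<open>i\<close>, which
    makes the sets \<open>D i\<close> disjoint.\<close>
  have len: "length (takeWhile (\<lambda>x. x \<noteq> c) w) = i" if w: "w \<in> D i" for w i
  proof -
    obtain u v where "w = u @ c # v" "u \<in> A i" using w unfolding D_def by auto
    then have "takeWhile (\<lambda>x. x \<noteq> c) w = u"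
      using S unfolding A_def by (auto simp: takeWhile_append)
    then show ?thesis using \<open>u \<in> A i\<close> unfolding A_def by simp
  qed
  have "(\<Sum>w\<in>D i. f w) = word_sum f S i * word_sum f (insert c S) (n - 1 - i)" for i
  proof -
    have "inj_on (\<lambda>(u, v). u @ c # v) (A i \<times> B (n - 1 - i))"
      unfolding inj_on_def A_def by auto
    then have "(\<Sum>w\<in>D i. f w) = (\<Sum>(u, v)\<in>A i \<times> B (n - 1 - i). f u * f v)"
      unfolding D_def by (subst sum.reindex) (auto simp: mult intro!: sum.cong)
    also have "\<dots> = word_sum f S i * word_sum f (insert c S) (n - 1 - i)"
      unfolding word_sum_def A_def B_def by (simp add: sum_product sum.cartesian_product)
    finally show ?thesis .
  qed
  moreover have "D i \<inter> D j = {}" if "i \<noteq> j" for i j using len that by blast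
  then have "sum f (\<Union>i<n. D i) = (\<Sum>i<n. \<Sum>w\<in>D i. f w)"
    using fin by (intro sum.UNION_disjoint) (auto simp: D_def)
  moreover have "sum f (B n) = sum f (A n) + sum f (\<Union>i<n. D i)"
    unfolding Bn using fin disj unfolding D_def by (intro sum.union_disjoint) auto
  ultimately show ?thesis unfolding word_sum_def A_def B_def by simp
qed

lemma word_gf_insert:
  assumes "finite S" "c \<notin> S" "\<And>u v. f (u @ c # v) = f u * f v"
  shows "word_gf f (insert c S) * (1 - fps_X * word_gf f S) = word_gf f S"
proof -
  let ?N = "word_gf f S" and ?K = "word_gf f (insert c S)"
  have "?K = ?N + fps_X * (?N * ?K)"
  proof (rule fps_ext)
    fix n
    show "fps_nth ?K n = fps_nth (?N + fps_X * (?N * ?K)) n"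
    proof (cases n)
      case 0
      then show ?thesis using word_sum_insert[OF assms, of 0] unfolding word_gf_def by simp
    next
      case (Suc m)
      have "fps_nth (?N * ?K) m = (\<Sum>i\<le>m. word_sum f S i * word_sum f (insert c S) (m - i))"
        by (simp add: word_gf_def fps_mult_nth atLeast0AtMost)
      then show ?thesis using word_sum_insert[OF assms, of n] Suc
        by (simp add: word_gf_def lessThan_Suc_atMost)
    qed
  qed
  then show ?thesis by (simp add: algebra_simps)
qed

text \<open>
  The state of an interval \<open>[p, q]\<close> consists of the truth values of \<open>(p, q) \<in> X\<close> and \<open>(q, p) \<in> X\<close>.
\<close>
type_synonym state = "bool \<times> bool"

abbreviation full :: state where "full \<equiv> (True, True)"
abbreviation void :: state where "void \<equiv> (False, False)"

text \<open>The cell \<open>v ! i\<close> lies above \<open>w ! i\<close> and \<open>w ! Suc i\<close>.\<close>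
definition row_compat :: "state list \<Rightarrow> state list \<Rightarrow> bool" where
  "row_compat w v \<longleftrightarrow> length v = length w - 1 \<and>
     (\<forall>i. Suc i < length w \<and> (fst (w ! i) \<or> snd (w ! Suc i)) \<longrightarrow> v ! i = full)"

lemma row_compat_Nil [simp]: "row_compat [] v \<longleftrightarrow> v = []"
  unfolding row_compat_def by auto

lemma row_compat_single [simp]: "row_compat [a] v \<longleftrightarrow> v = []"
  unfolding row_compat_def by auto

lemma row_compat_Cons_Nil [simp]: "row_compat (a # b # w) [] \<longleftrightarrow> False"
  unfolding row_compat_def by auto

lemma row_compat_Cons_Cons [simp]:
  "row_compat (a # b # w) (c # v) \<longleftrightarrow> (fst a \<or> snd b \<longrightarrow> c = full) \<and> row_compat (b # w) v"
proof -
  have split: "(\<forall>i. P i) \<longleftrightarrow> P 0 \<and> (\<forall>i. P (Suc i))" for P :: "nat \<Rightarrow> bool"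
    using nat_induct[of P] by auto
  have "(\<forall>i. Suc i < length (a # b # w) \<and> (fst ((a # b # w) ! i) \<or> snd ((a # b # w) ! Suc i))
        \<longrightarrow> (c # v) ! i = full)
    \<longleftrightarrow> (fst a \<or> snd b \<longrightarrow> c = full) \<and>
      (\<forall>i. Suc i < length (b # w) \<and> (fst ((b # w) ! i) \<or> snd ((b # w) ! Suc i)) \<longrightarrow> v ! i = full)"
    by (subst split) simp
  then show ?thesis unfolding row_compat_def by auto
qed

lemma row_compat_length: "row_compat w v \<Longrightarrow> length v = length w - 1"
  unfolding row_compat_def by simp

lemma finite_row_compat: "finite {v. row_compat w v}"
  by (rule finite_subset[OF _ finite_lists_length_eq[of UNIV "length w - 1"]])
    (auto dest: row_compat_length)

section \<open>Fillings of a triangle and their splitting\<close>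

text \<open>The number of ways to fill the triangle above the bottom row \<open>w\<close>. The empty
  row is compatible with itself, so it needs a clause of its own for the recursion to end.\<close>

function fillings :: "state list \<Rightarrow> nat" where
  "fillings w = (if w = [] then 1 else \<Sum>v | row_compat w v. fillings v)"
  by auto
termination
  by (relation "measure length") (auto dest!: row_compat_length)

declare fillings.simps [simp del]

lemma fillings_Nil [simp]: "fillings [] = 1"
  by (simp add: fillings.simps)

lemma fillings_rec: "w \<noteq> [] \<Longrightarrow> fillings w = (\<Sum>v | row_compat w v. fillings v)"
  by (simp add: fillings.simps)

lemma row_compat_full_Cons:
  "v \<noteq> [] \<Longrightarrow> row_compat (full # v) z \<longleftrightarrow> (\<exists>v'. z = full # v' \<and> row_compat v v')"
  by (cases v; cases z) auto

text \<open>The letter above the last letter of \<open>u\<close> and \<open>full\<close> is forced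
  to be full; on its two sides the next row depends on \<open>u\<close> and on
  \<open>full # v\<close> alone.\<close>

lemma row_compat_append_full:
  "u \<noteq> [] \<Longrightarrow> row_compat (u @ full # v) w \<longleftrightarrow>
    (\<exists>u' z. w = u' @ full # z \<and> row_compat u u' \<and> row_compat (full # v) z)"
proof (induction u arbitrary: w)
  case (Cons a u)
  show ?case
  proof (cases u)
    case Nil
    then show ?thesis by (cases w) auto
  next
    case (Cons b us)
    show ?thesis
    proof (cases w)
      case Nil
      then show ?thesis using Cons by auto
    next
      case w: (Cons c w')
      have IH: "row_compat (b # us @ full # v) w' \<longleftrightarrow>
          (\<exists>u' z. w' = u' @ full # z \<and> row_compat (b # us) u' \<and> row_compat (full # v) z)"
        using Cons.IH[of w'] Cons by simp
      have "row_compat ((a # u) @ full # v) w \<longleftrightarrow> (fst a \<or> snd b \<longrightarrow> c = full) \<and>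
          (\<exists>u' z. w' = u' @ full # z \<and> row_compat (b # us) u' \<and> row_compat (full # v) z)"
        using Cons w IH by simp
      also have "\<dots> \<longleftrightarrow> (\<exists>u' z. w = (c # u') @ full # z \<and> row_compat (a # b # us) (c # u') \<and> row_compat (full # v) z)"
        using w by auto
      also have "\<dots> \<longleftrightarrow> (\<exists>u' z. w = u' @ full # z \<and> row_compat (a # b # us) u' \<and> row_compat (full # v) z)"
      proof
        assume "\<exists>u' z. w = u' @ full # z \<and> row_compat (a # b # us) u' \<and> row_compat (full # v) z"
        then obtain u' z where "w = u' @ full # z" "row_compat (a # b # us) u'" "row_compat (full # v) z"
          by blast
        then show "\<exists>u' z. w = (c # u') @ full # z \<and> row_compat (a # b # us) (c # u') \<and> row_compat (full # v) z"
          using w by (cases u') auto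
      qed blast
      finally show ?thesis using Cons by simp
    qed
  qed
qed simp

text \<open>The leading full letter reproduces itself at the left end of the rows above and never
  offers a choice.\<close>

lemma fillings_full_Cons: "fillings (full # v) = fillings v"
proof (induction "length v" arbitrary: v rule: less_induct)
  case less
  show ?case
  proof (cases "v = []")
    case True
    then show ?thesis by (simp add: fillings_rec)
  next
    case False
    have "{z. row_compat (full # v) z} = (#) full ` {v'. row_compat v v'}"
      using row_compat_full_Cons[OF False] by auto
    then have "fillings (full # v) = (\<Sum>v' | row_compat v v'. fillings (full # v'))"
      by (simp add: fillings_rec sum.reindex)
    also have "\<dots> = (\<Sum>v' | row_compat v v'. fillings v')"
      using less False by (intro sum.cong) (auto dest!: row_compat_length)
    finally show ?thesis using False by (simp add: fillings_rec)
  qed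
qed

text \<open>A full letter persists in the next row while the part to its left gets shorter, so
  induction on \<open>length u\<close> separates two independent triangles.\<close>

lemma fillings_append_full: "fillings (u @ full # v) = fillings u * fillings v"
proof (induction "length u" arbitrary: u v rule: less_induct)
  case less
  show ?case
  proof (cases "u = []")
    case True
    then show ?thesis by (simp add: fillings_full_Cons)
  next
    case False
    have im: "{w. row_compat (u @ full # v) w} =
        (\<lambda>(u', z). u' @ full # z) ` ({u'. row_compat u u'} \<times> {z. row_compat (full # v) z})"
      using row_compat_append_full[OF False] by auto
    have inj: "inj_on (\<lambda>(u', z). u' @ full # z) ({u'. row_compat u u'} \<times> {z. row_compat (full # v) z})"
      by (auto simp: inj_on_def dest!: row_compat_length)
    have "fillings (u @ full # v) = (\<Sum>w | row_compat (u @ full # v) w. fillings w)"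
      by (simp add: fillings_rec)
    also have "\<dots> =
        (\<Sum>(u', z)\<in>{u'. row_compat u u'} \<times> {z. row_compat (full # v) z}. fillings (u' @ full # z))"
      unfolding im sum.reindex[OF inj] by (simp add: case_prod_unfold)
    also have "\<dots> = (\<Sum>(u', z)\<in>{u'. row_compat u u'} \<times> {z. row_compat (full # v) z}. fillings u' * fillings z)"
      using less False by (intro sum.cong) (auto dest!: row_compat_length)
    also have "\<dots> = fillings u * fillings (full # v)"
      using False by (simp add: fillings_rec[of u] fillings_rec[of "full # v"] sum_product sum.cartesian_product)
    finally show ?thesis by (simp add: fillings_full_Cons)
  qed
qed

section \<open>Rows that fit below a given row\<close>

definition partial_states :: "state set" where
  "partial_states = UNIV - {full}"

definition predecessors :: "state list \<Rightarrow> state list set" where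
  "predecessors v = {w. set w \<subseteq> partial_states \<and> length w = Suc (length v) \<and> row_compat w v}"

text \<open>A full letter puts no constraint on the two letters beneath it, so the lower row splits
  between them.\<close>

lemma row_compat_append:
  "length w1 = Suc (length u) \<Longrightarrow> w2 \<noteq> [] \<Longrightarrow>
    row_compat (w1 @ w2) (u @ full # v) \<longleftrightarrow> row_compat w1 u \<and> row_compat w2 v"
proof (induction u arbitrary: w1)
  case Nil
  then obtain a where "w1 = [a]" by (cases w1) auto
  moreover obtain b w where "w2 = b # w" using Nil by (cases w2) auto
  ultimately show ?case by simp
next
  case (Cons c u)
  then obtain a b w where w1: "w1 = a # b # w" by (cases w1; cases "tl w1") auto
  then show ?case using Cons.IH[of "b # w"] Cons.prems by simp
qed

lemma card_predecessors_append:
  "card (predecessors (u @ full # v)) = card (predecessors u) * card (predecessors v)"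
proof -
  have "predecessors (u @ full # v) = (\<lambda>(a, b). a @ b) ` (predecessors u \<times> predecessors v)"
  proof (intro equalityI subsetI)
    fix w assume w: "w \<in> predecessors (u @ full # v)"
    let ?a = "take (Suc (length u)) w" and ?b = "drop (Suc (length u)) w"
    have len: "length ?a = Suc (length u)" "length ?b = Suc (length v)"
      using w unfolding predecessors_def by auto
    then have "row_compat ?a u \<and> row_compat ?b v"
      using row_compat_append[of ?a u ?b v] w unfolding predecessors_def by fastforce
    moreover have "set ?a \<subseteq> partial_states" "set ?b \<subseteq> partial_states"
      using w set_take_subset set_drop_subset unfolding predecessors_def by fastforce+
    ultimately have "(?a, ?b) \<in> predecessors u \<times> predecessors v"
      using len unfolding predecessors_def by simp
    moreover have "w = (\<lambda>(a, b). a @ b) (?a, ?b)" by simp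
    ultimately show "w \<in> (\<lambda>(a, b). a @ b) ` (predecessors u \<times> predecessors v)" by blast
  next
    fix w assume "w \<in> (\<lambda>(a, b). a @ b) ` (predecessors u \<times> predecessors v)"
    then obtain a b where ab: "w = a @ b" "a \<in> predecessors u" "b \<in> predecessors v" by auto
    then have "b \<noteq> []" unfolding predecessors_def by auto
    then have "row_compat w (u @ full # v)"
      using row_compat_append[of a u b v] ab unfolding predecessors_def by auto
    then show "w \<in> predecessors (u @ full # v)" using ab unfolding predecessors_def by auto
  qed
  moreover have "inj_on (\<lambda>(a, b). a @ b) (predecessors u \<times> predecessors v)"
    unfolding inj_on_def predecessors_def by auto
  ultimately show ?thesis by (simp add: card_image card_cartesian_product)
qed

text \<open>With no full letter above, only the last letter may have its first component set and
  only the first letter its second. Inner letters are void and two choices remain at each end; a row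
  of one letter is any of the three partial states.\<close>

lemma card_predecessors_partial:
  assumes "set u \<subseteq> partial_states"
  shows "card (predecessors u) = (if u = [] then 3 else 4)"
proof -
  \<comment> \<open>The rows that can be continued to the left.\<close>
  define E where "E u = {w \<in> predecessors u. \<not> snd (hd w)}" for u
  have ps: "partial_states = {void, (True, False), (False, True)}"
    unfolding partial_states_def by auto
  have pn: "predecessors [] = (\<lambda>a. [a]) ` partial_states"
    unfolding predecessors_def by (auto simp: length_Suc_conv)
  have step: "predecessors (c # u) = (\<lambda>(a, w). a # w) ` ({a \<in> partial_states. \<not> fst a} \<times> E u)"
    if "c \<in> partial_states" for c u
  proof (intro equalityI subsetI)
    fix x assume x: "x \<in> predecessors (c # u)"
    then obtain a b w where abw: "x = a # b # w" unfolding predecessors_def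
      by (cases x; cases "tl x") auto
    then have "(a, b # w) \<in> {a \<in> partial_states. \<not> fst a} \<times> E u"
      using x that unfolding predecessors_def E_def partial_states_def by auto
    then show "x \<in> (\<lambda>(a, w). a # w) ` ({a \<in> partial_states. \<not> fst a} \<times> E u)"
      using abw by force
  next
    fix x assume "x \<in> (\<lambda>(a, w). a # w) ` ({a \<in> partial_states. \<not> fst a} \<times> E u)"
    then obtain a w where aw: "x = a # w" "a \<in> partial_states" "\<not> fst a" "w \<in> E u" by auto
    then obtain b w' where "w = b # w'" unfolding E_def predecessors_def by (cases w) auto
    then show "x \<in> predecessors (c # u)" using aw unfolding E_def predecessors_def by auto
  qed
  have inj: "inj_on (\<lambda>(a, w). a # w) X" for X :: "(state \<times> state list) set"
    by (auto simp: inj_on_def)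
  have E_step: "E (c # u) = (\<lambda>w. void # w) ` E u" if "c \<in> partial_states" for c u
    unfolding E_def[of "c # u"] step[OF that] by (auto simp: ps)
  have E2: "card (E u) = 2" if "set u \<subseteq> partial_states" for u
    using that
  proof (induction u)
    case Nil
    have "E [] = {[void], [(True, False)]}" unfolding E_def pn ps by auto
    then show ?case by simp
  next
    case (Cons c u)
    then show ?case by (simp add: E_step card_image)
  qed
  show ?thesis
  proof (cases u)
    case Nil
    then show ?thesis by (simp add: pn card_image inj_on_def) (simp add: ps)
  next
    case (Cons c u')
    have "card (E u') = 2" using E2 assms unfolding Cons by simp
    moreover have "{a \<in> partial_states. \<not> fst a} = {void, (False, True)}" unfolding ps by auto
    ultimately show ?thesis
      using assms unfolding Cons by (simp add: step card_image[OF inj] card_cartesian_product)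
  qed
qed

lemma word_sum_0 [simp]: "word_sum f S 0 = f []"
proof -
  have "{w. set w \<subseteq> S \<and> length w = 0} = {[]}" by auto
  then show ?thesis unfolding word_sum_def by simp
qed

text \<open>Double counting of the pairs formed by a bottom row and the row above it.\<close>

lemma word_sum_fillings_Suc:
  "word_sum fillings partial_states (Suc n) = word_sum (\<lambda>v. fillings v * card (predecessors v)) UNIV n"
proof -
  let ?W = "{w. set w \<subseteq> partial_states \<and> length w = Suc n}" and ?V = "{v :: state list. length v = n}"
  have fW: "finite ?W" by (rule finite_lists_length_eq) simp
  have fV: "finite ?V" using finite_lists_length_eq[of "UNIV :: state set" n] by simp
  have "word_sum fillings partial_states (Suc n) = (\<Sum>w\<in>?W. \<Sum>v | row_compat w v. fillings v)"
    unfolding word_sum_def by (intro sum.cong) (auto intro!: fillings_rec)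
  also have "\<dots> = (\<Sum>w\<in>?W. \<Sum>v | v \<in> ?V \<and> row_compat w v. fillings v)"
    by (intro sum.cong) (auto dest: row_compat_length)
  also have "\<dots> = (\<Sum>v\<in>?V. \<Sum>w | w \<in> ?W \<and> row_compat w v. fillings v)"
    by (rule sum.swap_restrict[OF fW fV])
  also have "\<dots> = (\<Sum>v\<in>?V. fillings v * card (predecessors v))"
  proof (rule sum.cong)
    fix v :: "state list" assume "v \<in> ?V"
    then have "{w. w \<in> ?W \<and> row_compat w v} = predecessors v" unfolding predecessors_def by auto
    then show "(\<Sum>w | w \<in> ?W \<and> row_compat w v. fillings v) = fillings v * card (predecessors v)" by simp
  qed simp
  finally show ?thesis unfolding word_sum_def by simp
qed

lemma insert_full_partial: "insert full partial_states = UNIV" "full \<notin> partial_states"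
  unfolding partial_states_def by auto

lemma fps_Suc_eq:
  assumes "fps_nth F 0 = (1 :: real)" "\<And>n. fps_nth F (Suc n) = fps_nth G n"
  shows "F = 1 + fps_X * G"
proof (rule fps_ext)
  fix n show "fps_nth F n = fps_nth (1 + fps_X * G) n" using assms by (cases n) auto
qed

section \<open>Functional equations\<close>

text \<open>This is the series \<open>N\<close> of the introduction, and \<open>void_gf\<close> is
  \<open>A\<close>. In \<open>diagonal_gf\<close> only \<open>void\<close> and \<open>full\<close>
  occur, because the one label \<open>(p, p)\<close> fills both components of the state of
  \<open>[p, p]\<close>.\<close>

definition partial_gf :: "real fps" where "partial_gf = word_gf fillings partial_states"
definition filling_gf :: "real fps" where "filling_gf = word_gf fillings UNIV"
definition void_gf :: "real fps" where "void_gf = word_gf fillings {void}"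
definition diagonal_gf :: "real fps" where "diagonal_gf = word_gf fillings {void, full}"

text \<open>Deleting the bottom row of a nonempty partial word leaves an arbitrary row, weighted by
  the number of its predecessors. This weight is again multiplicative at full letters.\<close>

lemma partial_gf_eq: "partial_gf * (1 + fps_X - 4 * fps_X * partial_gf) = 1"
proof -
  let ?f = "\<lambda>v. fillings v * card (predecessors v)"
  have mult: "?f (u @ full # v) = ?f u * ?f v" for u v
    by (simp add: fillings_append_full card_predecessors_append)
  define K where "K = word_gf ?f UNIV"
  define M where "M = word_gf ?f partial_states"
  have K: "K * (1 - fps_X * M) = M"
    using word_gf_insert[OF _ insert_full_partial(2), of ?f, OF _ mult]
    unfolding insert_full_partial K_def M_def by simp
  have "word_sum ?f partial_states n = (if n = 0 then 3 else 4) * word_sum fillings partial_states n" for n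
    unfolding word_sum_def sum_distrib_left
    by (rule sum.cong) (auto simp: card_predecessors_partial)
  \<comment> \<open>The empty word has three predecessors instead of four, hence the correction by
    1.\<close>
  then have M: "M = 4 * partial_gf - 1"
    unfolding M_def partial_gf_def word_gf_def by (intro fps_ext) (simp add: fps_numeral_nth_0 numeral_fps_const)
  have N: "partial_gf = 1 + fps_X * K"
    by (rule fps_Suc_eq) (simp_all add: partial_gf_def K_def word_gf_def word_sum_fillings_Suc)
  have "partial_gf * (1 - fps_X * M) = 1 - fps_X * M + fps_X * (K * (1 - fps_X * M))"
    unfolding N by (simp add: algebra_simps)
  also have "\<dots> = 1" unfolding K by simp
  finally show ?thesis unfolding M by (simp add: algebra_simps)
qed

lemma filling_gf_eq: "filling_gf * (1 - fps_X * partial_gf) = partial_gf"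
  using word_gf_insert[OF _ insert_full_partial(2) fillings_append_full]
  unfolding insert_full_partial filling_gf_def partial_gf_def by simp

text \<open>A row of void letters forces nothing, so the row above it is arbitrary.\<close>

lemma void_gf_eq: "void_gf * (1 - fps_X * partial_gf) = 1"
proof -
  have tot: "word_sum fillings {void} n = fillings (replicate n void)" for n
  proof -
    have "{w. set w \<subseteq> {void} \<and> length w = n} = {replicate n void}"
    proof (intro equalityI subsetI)
      fix w :: "state list" assume "w \<in> {w. set w \<subseteq> {void} \<and> length w = n}"
      then have "\<And>y. y \<in> set w \<Longrightarrow> y = void" "length w = n" by blast+
      then show "w \<in> {replicate n void}" using replicate_eqI[of w n void] by simp
    qed auto
    then show ?thesis unfolding word_sum_def by simp
  qed
  have "fillings (replicate (Suc n) void) = word_sum fillings UNIV n" for n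
  proof -
    have "{v. row_compat (replicate (Suc n) void) v} = {v. set v \<subseteq> UNIV \<and> length v = n}"
      unfolding row_compat_def by (auto simp: nth_Cons')
    then show ?thesis unfolding word_sum_def by (simp add: fillings_rec)
  qed
  then have V: "void_gf = 1 + fps_X * filling_gf"
    by (intro fps_Suc_eq) (simp_all only: void_gf_def filling_gf_def word_gf_def tot fps_nth_Abs_fps
      replicate_0 fillings_Nil of_nat_1)
  have "void_gf * (1 - fps_X * partial_gf)
      = 1 - fps_X * partial_gf + fps_X * (filling_gf * (1 - fps_X * partial_gf))"
    unfolding V by (simp add: algebra_simps)
  then show ?thesis unfolding filling_gf_eq by simp
qed

lemma diagonal_gf_eq: "diagonal_gf * (1 - fps_X * void_gf) = void_gf"
  using word_gf_insert[of "{void}" full fillings, OF _ _ fillings_append_full]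
  unfolding diagonal_gf_def void_gf_def by (simp add: insert_commute)

section \<open>Closed label sets as chains of rows\<close>

text \<open>Total functions on \<open>nat\<close> can be compared directly with
  \<open>label_rows m X\<close>; from level \<open>length w\<close> on, all rows are empty.\<close>

definition row_chains :: "state list \<Rightarrow> (nat \<Rightarrow> state list) set" where
  "row_chains w = {\<rho>. \<rho> 0 = w \<and> (\<forall>l. row_compat (\<rho> l) (\<rho> (Suc l)))}"

lemma row_chains_length: "\<rho> \<in> row_chains w \<Longrightarrow> length (\<rho> l) = length w - l"
proof (induction l)
  case (Suc l)
  then have "length (\<rho> (Suc l)) = length (\<rho> l) - 1"
    using row_compat_length unfolding row_chains_def by blast
  then show ?case using Suc by simp
qed (simp add: row_chains_def)

lemma row_chains_Nil: "row_chains [] = {\<lambda>_. []}"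
proof (intro equalityI subsetI)
  fix \<rho> assume "\<rho> \<in> row_chains []"
  then have "length (\<rho> l) = 0" for l using row_chains_length by fastforce
  then show "\<rho> \<in> {\<lambda>_. []}" by auto
qed (simp add: row_chains_def)

lemma row_chains_rec: "row_chains w = (\<Union>v\<in>{v. row_compat w v}. case_nat w ` row_chains v)"
proof (intro equalityI subsetI)
  fix \<rho> assume r: "\<rho> \<in> row_chains w"
  have "\<rho> = case_nat w (\<lambda>l. \<rho> (Suc l))"
    using r unfolding row_chains_def by (auto split: nat.split)
  moreover have "(\<lambda>l. \<rho> (Suc l)) \<in> row_chains (\<rho> 1)" "row_compat w (\<rho> 1)"
    using r unfolding row_chains_def by auto
  ultimately show "\<rho> \<in> (\<Union>v\<in>{v. row_compat w v}. case_nat w ` row_chains v)" by blast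
next
  fix \<rho> assume "\<rho> \<in> (\<Union>v\<in>{v. row_compat w v}. case_nat w ` row_chains v)"
  then show "\<rho> \<in> row_chains w" unfolding row_chains_def by (auto split: nat.split)
qed

lemma card_row_chains: "finite (row_chains w) \<and> card (row_chains w) = fillings w"
proof (induction "length w" arbitrary: w rule: less_induct)
  case less
  show ?case
  proof (cases "w = []")
    case True
    then show ?thesis by (simp add: row_chains_Nil)
  next
    case False
    then have IH: "finite (row_chains v) \<and> card (row_chains v) = fillings v" if "row_compat w v" for v
      using less row_compat_length[OF that] by (metis diff_less length_greater_0_conv zero_less_one)
    have inj: "inj_on (case_nat w) X" for X :: "(nat \<Rightarrow> state list) set"
    proof (rule inj_onI, rule ext)
      fix f g :: "nat \<Rightarrow> state list" and x assume "case_nat w f = case_nat w g"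
      then have "case_nat w f (Suc x) = case_nat w g (Suc x)" by metis
      then show "f x = g x" by simp
    qed
    have disj: "case_nat w ` row_chains u \<inter> case_nat w ` row_chains v = {}" if "u \<noteq> v" for u v
    proof -
      have "f 1 = v" if "f \<in> case_nat w ` row_chains v" for f v using that unfolding row_chains_def by auto
      then show ?thesis using that by blast
    qed
    have fin: "finite (case_nat w ` row_chains v)" if "row_compat w v" for v using IH[OF that] by simp
    have "card (row_chains w) = (\<Sum>v | row_compat w v. card (case_nat w ` row_chains v))"
      unfolding row_chains_rec[of w] using finite_row_compat fin disj by (intro card_UN_disjoint) auto
    also have "\<dots> = fillings w"
      using IH False by (simp add: card_image[OF inj] fillings_rec)
    finally show ?thesis unfolding row_chains_rec[of w] using finite_row_compat fin by auto
  qed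
qed

definition label_rows :: "nat \<Rightarrow> (nat \<times> nat) set \<Rightarrow> nat \<Rightarrow> state list" where
  "label_rows m X l = map (\<lambda>i. ((Suc i, Suc i + l) \<in> X, (Suc i + l, Suc i) \<in> X)) [0..<m - l]"

lemma length_label_rows [simp]: "length (label_rows m X l) = m - l"
  unfolding label_rows_def by simp

lemma nth_label_rows [simp]:
  "i < m - l \<Longrightarrow> label_rows m X l ! i = ((Suc i, Suc i + l) \<in> X, (Suc i + l, Suc i) \<in> X)"
  unfolding label_rows_def by simp

text \<open>The intervals \<open>[p, q - 1]\<close> and \<open>[p + 1, q]\<close> are neighbours on
  one diagonal and lie below \<open>[p, q]\<close> on the next, so the forcing rule is compatibility
  of consecutive rows.\<close>

lemma label_closed_iff_rows:
  "label_closed (Suc m) X \<longleftrightarrow> (\<forall>l. row_compat (label_rows m X l) (label_rows m X (Suc l)))"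
proof
  assume X: "label_closed (Suc m) X"
  show "\<forall>l. row_compat (label_rows m X l) (label_rows m X (Suc l))"
  proof
    fix l
    have "label_rows m X (Suc l) ! i = full"
      if "Suc i < m - l" "fst (label_rows m X l ! i) \<or> snd (label_rows m X l ! Suc i)" for i
    proof -
      have "(Suc i, Suc i + l) \<in> X \<or> (Suc (Suc i) + l, Suc (Suc i)) \<in> X" "i < m - Suc l"
        using that by auto
      then show ?thesis using label_closedD[OF X, of "Suc i" "Suc i + Suc l"] that by auto
    qed
    then show "row_compat (label_rows m X l) (label_rows m X (Suc l))"
      unfolding row_compat_def by (simp only: length_label_rows) auto
  qed
next
  assume rows: "\<forall>l. row_compat (label_rows m X l) (label_rows m X (Suc l))"
  show "label_closed (Suc m) X"
    unfolding label_closed_def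
  proof (intro allI impI)
    fix p q assume a: "1 \<le> p \<and> p < q \<and> q < Suc m \<and> ((p, q - 1) \<in> X \<or> (q, p + 1) \<in> X)"
    define i l where "i = p - 1" and "l = q - p - 1"
    have pq: "p = Suc i" "q = Suc i + Suc l" "Suc i < m - l" using a unfolding i_def l_def by auto
    have "fst (label_rows m X l ! i) \<or> snd (label_rows m X l ! Suc i)"
      using a pq by auto
    then have "label_rows m X (Suc l) ! i = full"
      using rows pq(3) unfolding row_compat_def by (simp only: length_label_rows)
    moreover have "i < m - Suc l" using pq(3) by simp
    ultimately show "(p, q) \<in> X \<and> (q, p) \<in> X" using pq by simp
  qed
qed

lemma card_label_closed:
  "card {X. X \<subseteq> labels (Suc m) \<and> label_closed (Suc m) X} = word_sum fillings {void, full} m"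
proof -
  let ?D = "{w. set w \<subseteq> {void, full} \<and> length w = m}"
  have "bij_betw (label_rows m) {X. X \<subseteq> labels (Suc m) \<and> label_closed (Suc m) X} (\<Union>w\<in>?D. row_chains w)"
  proof (rule bij_betwI')
    fix X Y assume XY: "X \<in> {X. X \<subseteq> labels (Suc m) \<and> label_closed (Suc m) X}"
      "Y \<in> {X. X \<subseteq> labels (Suc m) \<and> label_closed (Suc m) X}"
    show "label_rows m X = label_rows m Y \<longleftrightarrow> X = Y"
    proof
      assume eq: "label_rows m X = label_rows m Y"
      have "(x, y) \<in> X \<longleftrightarrow> (x, y) \<in> Y" if xy: "(x, y) \<in> labels (Suc m)" for x y
      proof (cases "x \<le> y")
        case True
        have "label_rows m X (y - x) ! (x - 1) = label_rows m Y (y - x) ! (x - 1)" using eq by simp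
        then show ?thesis using xy True unfolding labels_def by auto
      next
        case False
        have "label_rows m X (x - y) ! (y - 1) = label_rows m Y (x - y) ! (y - 1)" using eq by simp
        then show ?thesis using xy False unfolding labels_def by auto
      qed
      then show "X = Y" using XY by (intro equalityI subrelI) blast+
    qed simp
  next
    fix X assume X: "X \<in> {X. X \<subseteq> labels (Suc m) \<and> label_closed (Suc m) X}"
    then have "label_rows m X \<in> row_chains (label_rows m X 0)"
      unfolding row_chains_def using label_closed_iff_rows by auto
    moreover have "label_rows m X 0 \<in> ?D" unfolding label_rows_def by auto
    ultimately show "label_rows m X \<in> (\<Union>w\<in>?D. row_chains w)" by blast
  next
    fix \<rho> assume "\<rho> \<in> (\<Union>w\<in>?D. row_chains w)"
    then obtain w where w: "set w \<subseteq> {void, full}" "length w = m" and r: "\<rho> \<in> row_chains w" by auto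
    define X where "X = {(x, y) \<in> labels (Suc m).
      if x \<le> y then fst (\<rho> (y - x) ! (x - 1)) else snd (\<rho> (x - y) ! (y - 1))}"
    have "label_rows m X l = \<rho> l" for l
    proof (rule nth_equalityI)
      show len: "length (label_rows m X l) = length (\<rho> l)"
        using row_chains_length[OF r, of l] w by simp
      fix i assume "i < length (label_rows m X l)"
      then have i: "i < m - l" by simp
      then have nth: "label_rows m X l ! i = ((Suc i, Suc i + l) \<in> X, (Suc i + l, Suc i) \<in> X)"
        by simp
      have lab: "(Suc i, Suc i + l) \<in> labels (Suc m)" "(Suc i + l, Suc i) \<in> labels (Suc m)"
        using i unfolding labels_def by auto
      show "label_rows m X l ! i = \<rho> l ! i"
      proof (cases "l = 0")
        \<comment> \<open>On the first diagonal both components describe the single label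
          \<open>(x, x)\<close>, so they must agree; this is where the bottom row being over
          \<open>void\<close> and \<open>full\<close> enters.\<close>
        case True
        have "\<rho> 0 ! i \<in> {void, full}"
          using r w i True unfolding row_chains_def by (auto dest!: nth_mem)
        then show ?thesis unfolding nth using lab True unfolding X_def by auto
      next
        case False
        then show ?thesis unfolding nth using lab unfolding X_def by (auto simp: prod_eq_iff)
      qed
    qed
    then have eq: "label_rows m X = \<rho>" by auto
    have "label_closed (Suc m) X"
      unfolding label_closed_iff_rows eq using r unfolding row_chains_def by auto
    moreover have "X \<subseteq> labels (Suc m)" unfolding X_def by auto
    ultimately show "\<exists>X\<in>{X. X \<subseteq> labels (Suc m) \<and> label_closed (Suc m) X}. \<rho> = label_rows m X"
      using eq by auto
  qed
  then have "card {X. X \<subseteq> labels (Suc m) \<and> label_closed (Suc m) X} = card (\<Union>w\<in>?D. row_chains w)"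
    by (rule bij_betw_same_card)
  also have "\<dots> = (\<Sum>w\<in>?D. card (row_chains w))"
  proof (rule card_UN_disjoint)
    show "finite ?D" by (rule finite_lists_length_eq) simp
    show "\<forall>w\<in>?D. finite (row_chains w)" using card_row_chains by blast
    show "\<forall>v\<in>?D. \<forall>w\<in>?D. v \<noteq> w \<longrightarrow> row_chains v \<inter> row_chains w = {}" unfolding row_chains_def by auto
  qed
  also have "\<dots> = word_sum fillings {void, full} m" unfolding word_sum_def using card_row_chains by simp
  finally show ?thesis .
qed

section \<open>Generating functions\<close>

lemma num_congruences_Suc: "num_congruences (Suc m) = word_sum fillings {void, full} m"
  using card_sTam_congruences[of "Suc m"] card_pointer_congruences[of "Suc m"] card_label_closed[of m]
  unfolding num_congruences_def congruence_lattice_def by simp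

lemma congruences_gf_eq: "congruences_gf * (1 - fps_X * void_gf) = 1"
proof -
  have C: "congruences_gf = 1 + fps_X * diagonal_gf"
    by (rule fps_Suc_eq)
      (simp_all add: congruences_gf_def diagonal_gf_def word_gf_def num_congruences_Suc,
        simp add: num_congruences_def)
  have "congruences_gf * (1 - fps_X * void_gf)
      = 1 - fps_X * void_gf + fps_X * (diagonal_gf * (1 - fps_X * void_gf))"
    unfolding C by (simp add: algebra_simps)
  then show ?thesis unfolding diagonal_gf_eq by simp
qed

section \<open>The closed form and the continued fraction\<close>

text \<open>Squaring \<open>R = B - 2xN\<close> and using \<open>B^2 - P = 4x\<close> leaves the
  equation multiplied by \<open>4x\<close>, which cancels.\<close>

lemma N_fps_quadratic:
  "N_fps l * (1 + fps_X - fps_const l * fps_X) - fps_X * N_fps l ^ 2 = 1"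
proof -
  define P :: "real fps" where
    "P = 1 - fps_const (2 * (l + 1)) * fps_X + fps_const ((l - 1)^2) * fps_X^2"
  define R where "R = fps_radical root 2 P"
  define B :: "real fps" where "B = 1 + fps_X - fps_const l * fps_X"
  have P0: "fps_nth P 0 = 1" unfolding P_def by (simp add: power2_eq_square)
  have R2: "R ^ 2 = P"
    using power_radical[of P root 1] P0 unfolding R_def by (simp add: numeral_2_eq_2)
  have R0: "fps_nth R 0 = 1" unfolding R_def using P0 by (simp add: fps_radical_def numeral_2_eq_2)
  \<comment> \<open>The constant terms cancel, which makes the division by \<open>2x\<close> in
    \<open>N_fps\<close> exact.\<close>
  have BR0: "fps_nth (B - R) 0 = 0" using R0 unfolding B_def by simp
  define Q where "Q = fps_shift 1 (B - R)"
  have Q: "B - R = fps_X * Q"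
  proof (rule fps_ext)
    fix n show "fps_nth (B - R) n = fps_nth (fps_X * Q) n"
      using BR0 unfolding Q_def by (cases n) simp_all
  qed
  have half: "2 * fps_const (1/2) = (1 :: real fps)" by (simp add: numeral_fps_const)
  have "(2 * fps_X) * (fps_const (1/2) * Q) = (2 * fps_const (1/2)) * (fps_X * Q)"
    by (simp only: mult_ac)
  then have "B - R = (2 * fps_X) * (fps_const (1/2) * Q)" unfolding half Q by simp
  then have "2 * fps_X dvd B - R" by (rule dvdI)
  then have M: "2 * fps_X * N_fps l = B - R"
    unfolding N_fps_def B_def R_def P_def by (rule dvd_mult_div_cancel)
  have c: "fps_const (2 * (l + 1)) = 2 * (fps_const l + 1)" "fps_const ((l - 1)^2) = (fps_const l - 1)^2"
    by (simp_all add: numeral_fps_const power2_eq_square flip: fps_const_1_eq_1)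
  have id: "(1 + fps_X - k * fps_X)^2 - (1 - 2 * (k + 1) * fps_X + (k - 1)^2 * fps_X^2) = 4 * fps_X"
    for k :: "real fps"
    by (simp add: power2_eq_square algebra_simps)
  have BP: "B ^ 2 - P = 4 * fps_X"
    unfolding B_def P_def c by (rule id)
  have "R = B - 2 * fps_X * N_fps l" using M by simp
  then have "(B - 2 * fps_X * N_fps l) ^ 2 = P" using R2 by simp
  then have "4 * fps_X * (N_fps l * B - fps_X * N_fps l ^ 2) = 4 * fps_X * 1"
    using BP by (simp add: power2_eq_square algebra_simps)
  then have "N_fps l * B - fps_X * N_fps l ^ 2 = 1"
    by (subst (asm) mult_cancel_left) simp
  then show ?thesis unfolding B_def .
qed

text \<open>At \<open>l = 3/4\<close>, with \<open>4x\<close> for \<open>x\<close>, the quadratic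
  equation becomes that of \<open>partial_gf\<close>. Its solution is unique: the cofactor of the
  difference of two solutions has constant term 1.\<close>

lemma N_fps_compose: "N_fps (3/4) oo (4 * fps_X) = partial_gf"
proof -
  let ?M = "N_fps (3/4) oo (4 * fps_X)"
  have "(N_fps (3/4) * (1 + fps_X - fps_const (3/4) * fps_X) - fps_X * N_fps (3/4) ^ 2) oo (4 * fps_X)
      = 1 oo (4 * fps_X)"
    unfolding N_fps_quadratic ..
  then have "?M * (1 + 4 * fps_X - fps_const (3/4) * (4 * fps_X)) - 4 * fps_X * ?M ^ 2 = 1"
    by (simp add: fps_compose_mult_distrib fps_compose_add_distrib fps_compose_sub_distrib
        power2_eq_square)
  moreover have "fps_const (3/4) * (4 * fps_X) = (3 * fps_X :: real fps)"
    by (simp add: numeral_fps_const mult.assoc[symmetric])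
  ultimately have "?M * (1 + 4 * fps_X - 3 * fps_X) - 4 * fps_X * ?M ^ 2 = 1"
    by (simp only:)
  then have M: "?M * (1 + fps_X - 4 * fps_X * ?M) = 1"
    by (simp add: algebra_simps power2_eq_square)
  have "(?M - partial_gf) * (1 + fps_X - 4 * fps_X * (?M + partial_gf)) = 0"
    using M partial_gf_eq by (simp add: algebra_simps)
  moreover have "fps_nth (1 + fps_X - 4 * fps_X * (?M + partial_gf)) 0 = 1"
    by (simp add: mult.assoc)
  then have "1 + fps_X - 4 * fps_X * (?M + partial_gf) \<noteq> 0" by (metis fps_zero_nth zero_neq_one)
  ultimately show ?thesis by simp
qed

lemma divide_eq_of_inverse:
  fixes a b c :: "real fps"
  assumes "a * b = 1"
  shows "c / b = c * a"
proof -
  have "b \<noteq> 0" using assms by auto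
  moreover have "c = c * a * b" using assms by (simp add: mult.assoc)
  ultimately show ?thesis by (metis nonzero_mult_div_cancel_right)
qed

lemma cf_tail_nth_0: "fps_nth (cf_tail k) 0 = 1"
proof (induction k)
  case (Suc k)
  then show ?case by (simp add: fps_divide_unit mult.assoc)
qed simp

text \<open>\<open>partial_gf\<close> is the fixed point of the repeating level, and every further
  level multiplies the error by \<open>x\<close>.\<close>

lemma cf_truncation_tendsto: "cf_truncation \<longlonglongrightarrow> congruences_gf"
proof -
  let ?N = partial_gf and ?A = void_gf and ?F = congruences_gf
  define i where "i k = inverse (cf_tail k)" for k
  have i: "i k * cf_tail k = 1" for k
    unfolding i_def by (rule inverse_mult_eq_1) (simp add: cf_tail_nth_0)
  have diff: "i k - ?N = i k * ?N * ((1 + fps_X - 4 * fps_X * ?N) - cf_tail k)" for k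
  proof -
    have "i k * ?N * ((1 + fps_X - 4 * fps_X * ?N) - cf_tail k)
        = i k * (?N * (1 + fps_X - 4 * fps_X * ?N)) - ?N * (i k * cf_tail k)"
      by (simp add: algebra_simps)
    then show ?thesis unfolding partial_gf_eq i by simp
  qed
  have tail: "fps_X ^ Suc k dvd i k - ?N" for k
  proof (induction k)
    case 0
    have "i 0 - ?N = fps_X * (- 4 * i 0 * ?N * ?N)"
      by (subst diff) (simp add: algebra_simps)
    then show ?case by simp
  next
    case (Suc k)
    have "cf_tail (Suc k) = 1 + fps_X - 4 * fps_X * i k"
      by (simp add: divide_eq_of_inverse[OF i])
    then have "i (Suc k) - ?N = fps_X * (i k - ?N) * (4 * i (Suc k) * ?N)"
      by (subst diff) (simp add: algebra_simps)
    moreover have "fps_X ^ Suc (Suc k) dvd fps_X * (i k - ?N)" using Suc by simp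
    ultimately show ?case by (metis dvd_mult2)
  qed
  define a where "a k = inverse (1 - fps_X * i k)" for k
  have a: "a k * (1 - fps_X * i k) = 1" for k
    unfolding a_def by (rule inverse_mult_eq_1) simp
  define t where "t k = inverse (1 - fps_X * a k)" for k
  have t: "t k * (1 - fps_X * a k) = 1" for k
    unfolding t_def by (rule inverse_mult_eq_1) simp
  have T: "cf_truncation k = t k" for k
    unfolding cf_truncation_def divide_eq_of_inverse[OF i] divide_eq_of_inverse[OF a]
      divide_eq_of_inverse[OF t] by simp
  \<comment> \<open>Carries the error through the two outer levels, which keep the
    divisibility.\<close>
  have step: "x - y = x * y * fps_X * (u - v)"
    if "x * (1 - fps_X * u) = 1" "y * (1 - fps_X * v) = 1" for x y u v :: "real fps"
  proof -
    have "x - y = x * (y * (1 - fps_X * v)) - y * (x * (1 - fps_X * u))" using that by simp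
    then show ?thesis by (simp add: algebra_simps)
  qed
  have dvd: "fps_X ^ Suc k dvd t k - ?F" for k
    unfolding step[OF t congruences_gf_eq] step[OF a void_gf_eq] using tail[of k] by (simp add: dvd_mult)
  have zero: "fps_nth (t k - ?F) n = 0" if "n < Suc k" for k n
  proof -
    obtain D where "t k - ?F = fps_X ^ Suc k * D" using dvd[of k] by (rule dvdE)
    then show ?thesis using that by (simp only: fps_X_power_mult_nth if_True)
  qed
  show ?thesis unfolding tendsto_fps_iff
  proof
    fix n
    show "\<forall>\<^sub>F k in sequentially. fps_nth (cf_truncation k) n = fps_nth ?F n"
      using eventually_ge_at_top[of n]
    proof eventually_elim
      case (elim k)
      then show ?case using zero[of n k] T by simp
    qed
  qed
qed

theorem proposition10p14:
  shows "congruences_gf = 1 / (1 - fps_X / (1 - fps_X * (N_fps (3/4) oo (4 * fps_X))))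
       \<and> cf_truncation \<longlonglongrightarrow> congruences_gf"
  using cf_truncation_tendsto
  by (simp add: N_fps_compose divide_eq_of_inverse[OF void_gf_eq] divide_eq_of_inverse[OF congruences_gf_eq])

end
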